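(* Let $\mathbb{F}$ be a field of characteristic zero. The Hopf algebra morphism $F:\mathcal{M}at\to\mathcal{QS}ym$, $[M]\mapsto F(M,\mathbf{x})$, becomes surjective after extending scalars to $\mathbb{F}$, i.e. $F\otimes\mathbb{F}:\mathcal{M}at\otimes\mathbb{F}\to\mathcal{QS}ym\otimes\mathbb{F}$ is surjective.
   Context: For a matroid $M$ on finite ground set $E$ with bases $\mathcal{B}(M)$ and $f:E\to\mathbb{P}=\{1,2,\ldots\}$, $f$ is $M$-generic if the minimum of $f(B)=\sum_{e\in B}f(e)$ over bases is attained by a unique base; $F(M,\mathbf{x})=\sum_{f\ M\text{-generic}}\prod_{e\in E}x_{f(e)}$. $\mathcal{M}at$ is the free $\mathbb{Z}$-module with basis $[M]$ indexed by isomorphism classes of matroids (a Hopf algebra with product given by direct sum and coproduct $\Delta[M]=\sum_{A\subseteq E}[M|_A]\otimes[M/A]$), and $\mathcal{QS}ym$ is the Hopf algebra of quasisymmetric functions in $x_1,x_2,\ldots$ with integer coefficients; $F$ extended $\mathbb{Z}$-linearly is a Hopf algebra morphism. *)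

theory Defs
  imports Complex_Main "HOL-Library.Poly_Mapping" "HOL-Library.FuncSet"
begin

section \<open>Matroids\<close>

definition matroid_on :: "'a set \<Rightarrow> 'a set set \<Rightarrow> bool" where
  "matroid_on E Bs \<longleftrightarrow>
     finite E \<and> Bs \<noteq> {} \<and> (\<forall>B\<in>Bs. B \<subseteq> E) \<and>
     (\<forall>B1\<in>Bs. \<forall>B2\<in>Bs. \<forall>x\<in>B1 - B2. \<exists>y\<in>B2 - B1. insert y (B1 - {x}) \<in> Bs)"

lemma matroid_on_finite: "matroid_on E Bs \<Longrightarrow> finite E"
  by (simp add: matroid_on_def)

lemma matroid_on_subset: "matroid_on E Bs \<Longrightarrow> B \<in> Bs \<Longrightarrow> B \<subseteq> E"
  by (simp add: matroid_on_def)

definition iso_matroids :: "'a set \<times> 'a set set \<Rightarrow> 'b set \<times> 'b set set \<Rightarrow> bool" where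
  "iso_matroids M N \<longleftrightarrow>
     (\<exists>\<phi>. bij_betw \<phi> (fst M) (fst N) \<and> snd N = (\<lambda>B. \<phi> ` B) ` snd M)"

definition generic :: "'a set set \<Rightarrow> ('a \<Rightarrow> nat) \<Rightarrow> bool" where
  "generic Bs f \<longleftrightarrow> (\<exists>!B. B \<in> Bs \<and> (\<forall>B'\<in>Bs. sum f B \<le> sum f B'))"

lemma generic_obtain:
  assumes "generic Bs f"
  obtains B where "B \<in> Bs" "\<forall>B'\<in>Bs. sum f B \<le> sum f B'"
    "\<And>C. C \<in> Bs \<Longrightarrow> \<forall>B'\<in>Bs. sum f C \<le> sum f B' \<Longrightarrow> C = B"
proof -
  define P where "P B \<longleftrightarrow> B \<in> Bs \<and> (\<forall>B'\<in>Bs. sum f B \<le> sum f B')" for B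
  have "\<exists>!B. P B" using assms unfolding generic_def P_def .
  then obtain B where B: "P B" "\<And>C. P C \<Longrightarrow> C = B" by blast
  show thesis
  proof (rule that)
    show "B \<in> Bs" "\<forall>B'\<in>Bs. sum f B \<le> sum f B'" using B(1) unfolding P_def by simp_all
    show "C = B" if "C \<in> Bs" "\<forall>B'\<in>Bs. sum f C \<le> sum f B'" for C
      using B(2) that unfolding P_def by simp
  qed
qed

lemma iso_matroids_refl: "iso_matroids M M"
  unfolding iso_matroids_def by (rule exI[of _ id]) (auto simp: bij_betw_def)

lemma iso_matroids_trans:
  assumes "iso_matroids M N" "iso_matroids N P"
  shows "iso_matroids M P"
proof -
  from assms(1) obtain g where g: "bij_betw g (fst M) (fst N)" "snd N = (\<lambda>B. g ` B) ` snd M"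
    unfolding iso_matroids_def by blast
  from assms(2) obtain h where h: "bij_betw h (fst N) (fst P)" "snd P = (\<lambda>B. h ` B) ` snd N"
    unfolding iso_matroids_def by blast
  have "bij_betw (h \<circ> g) (fst M) (fst P)" by (rule bij_betw_trans[OF g(1) h(1)])
  moreover have "snd P = (\<lambda>B. (h \<circ> g) ` B) ` snd M"
    unfolding g(2) h(2) by (simp add: image_image image_comp)
  ultimately show ?thesis unfolding iso_matroids_def by (intro exI conjI)
qed

lemma iso_matroids_sym:
  assumes "iso_matroids M N" and sub: "\<And>B. B \<in> snd M \<Longrightarrow> B \<subseteq> fst M"
  shows "iso_matroids N M"
proof -
  from assms obtain g where g: "bij_betw g (fst M) (fst N)" "snd N = (\<lambda>B. g ` B) ` snd M"
    unfolding iso_matroids_def by blast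
  let ?h = "inv_into (fst M) g"
  have inj: "inj_on g (fst M)" using g by (auto simp: bij_betw_def)
  have "?h ` g ` B = B" if "B \<in> snd M" for B
    using inv_into_image_cancel[OF inj sub[OF that]] .
  hence "(\<lambda>B. ?h ` B) ` snd N = snd M" unfolding g by (auto simp: image_image image_iff)
  moreover have "bij_betw ?h (fst N) (fst M)" using g bij_betw_inv_into by blast
  ultimately show ?thesis unfolding iso_matroids_def by metis
qed

lemma matroid_on_image:
  assumes M: "matroid_on E Bs" and inj: "inj_on \<phi> E"
  shows "matroid_on (\<phi> ` E) ((\<lambda>B. \<phi> ` B) ` Bs)"
  unfolding matroid_on_def
proof (intro conjI ballI)
  show "finite (\<phi> ` E)" "(\<lambda>B. \<phi> ` B) ` Bs \<noteq> {}"
    using M by (auto simp: matroid_on_def)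
  show "C \<subseteq> \<phi> ` E" if "C \<in> (\<lambda>B. \<phi> ` B) ` Bs" for C
    using M that unfolding matroid_on_def by blast
  fix C1 C2 x assume C: "C1 \<in> (\<lambda>B. \<phi> ` B) ` Bs" "C2 \<in> (\<lambda>B. \<phi> ` B) ` Bs" "x \<in> C1 - C2"
  then obtain B1 B2 u where B: "B1 \<in> Bs" "B2 \<in> Bs" "C1 = \<phi> ` B1" "C2 = \<phi> ` B2"
    "x = \<phi> u" "u \<in> B1 - B2" by auto
  have sub: "B1 \<subseteq> E" "B2 \<subseteq> E" using matroid_on_subset[OF M] B by auto
  from M B obtain v where v: "v \<in> B2 - B1" "insert v (B1 - {u}) \<in> Bs"
    unfolding matroid_on_def by meson
  have "\<phi> v \<in> C2 - C1" using v sub inj unfolding B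
    by (auto dest: inj_onD)
  moreover have "insert (\<phi> v) (C1 - {x}) = \<phi> ` insert v (B1 - {u})"
    using B sub inj_on_image_set_diff[OF inj, of B1 "{u}"] by auto
  ultimately show "\<exists>y\<in>C2 - C1. insert y (C1 - {x}) \<in> (\<lambda>B. \<phi> ` B) ` Bs"
    using v(2) by (metis imageI)
qed

text \<open>
  Every finite matroid is isomorphic to one whose ground set consists of natural numbers
  (lemma \<open>matroid_iso_nat\<close>), so the isomorphism classes of finite matroids are represented
  by the isomorphism classes of matroids on finite subsets of \<^typ>\<open>nat\<close>.
\<close>

lemma matroid_iso_nat:
  assumes M: "matroid_on E Bs"
  shows "\<exists>(E'::nat set) Bs'. matroid_on E' Bs' \<and> iso_matroids (E, Bs) (E', Bs')"
proof -
  have "finite E" using M by (auto simp: matroid_on_def)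
  then obtain \<phi> :: "'a \<Rightarrow> nat" where inj: "inj_on \<phi> E"
    using finite_imp_inj_to_nat_seg by meson
  have "iso_matroids (E, Bs) (\<phi> ` E, (\<lambda>B. \<phi> ` B) ` Bs)"
    unfolding iso_matroids_def using inj by (auto simp: bij_betw_def)
  with matroid_on_image[OF M inj] show ?thesis by blast
qed

typedef matroid = "{(E :: nat set, Bs). matroid_on E Bs}"
proof
  show "({}, {{}}) \<in> {(E :: nat set, Bs). matroid_on E Bs}" by (auto simp: matroid_on_def)
qed

setup_lifting type_definition_matroid

lift_definition matroid_iso :: "matroid \<Rightarrow> matroid \<Rightarrow> bool" is iso_matroids .

quotient_type matroid_class = matroid / matroid_iso
proof (rule equivpI)
  show "reflp matroid_iso" by (rule reflpI, transfer) (rule iso_matroids_refl)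
  show "symp matroid_iso"
    by (rule sympI, transfer, rule iso_matroids_sym) (use matroid_on_subset in fastforce)+
  show "transp matroid_iso" by (rule transpI, transfer) (rule iso_matroids_trans)
qed

type_synonym mat = "matroid_class \<Rightarrow>\<^sub>0 int"

section \<open>Quasisymmetric functions\<close>

text \<open>
  A monomial in \<open>x\<^sub>1, x\<^sub>2, \<dots>\<close> is given by its exponents \<open>nat \<Rightarrow>\<^sub>0 nat\<close>, where the index \<open>i\<close>
  stands for the variable \<open>x\<^sub>i\<^sub>+\<^sub>1\<close>.  A formal power series with integer coefficients is a function
  from monomials to \<^typ>\<open>int\<close>.
\<close>

definition mdegree :: "(nat \<Rightarrow>\<^sub>0 nat) \<Rightarrow> nat" where
  "mdegree a = (\<Sum>i\<in>Poly_Mapping.keys a. Poly_Mapping.lookup a i)"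

definition list_monom :: "nat list \<Rightarrow> nat list \<Rightarrow> nat \<Rightarrow>\<^sub>0 nat" where
  "list_monom is cs = (\<Sum>t<length cs. Poly_Mapping.single (is ! t) (cs ! t))"

definition quasisymmetric :: "((nat \<Rightarrow>\<^sub>0 nat) \<Rightarrow> int) \<Rightarrow> bool" where
  "quasisymmetric h \<longleftrightarrow>
     (\<exists>d. \<forall>a. h a \<noteq> 0 \<longrightarrow> mdegree a \<le> d) \<and>
     (\<forall>cs is js. (\<forall>c\<in>set cs. 0 < c) \<and> length is = length cs \<and> length js = length cs \<and>
        sorted_wrt (<) is \<and> sorted_wrt (<) js \<longrightarrow> h (list_monom is cs) = h (list_monom js cs))"

lemma quasisymmetric_0: "quasisymmetric (\<lambda>_. 0)"
  by (simp add: quasisymmetric_def)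

lemma quasisymmetric_add:
  assumes "quasisymmetric g" "quasisymmetric h"
  shows "quasisymmetric (\<lambda>a. g a + h a)"
proof -
  from assms obtain d e where "\<forall>a. g a \<noteq> 0 \<longrightarrow> mdegree a \<le> d" "\<forall>a. h a \<noteq> 0 \<longrightarrow> mdegree a \<le> e"
    unfolding quasisymmetric_def by meson
  hence "g a + h a \<noteq> 0 \<longrightarrow> mdegree a \<le> max d e" for a
    by (cases "g a = 0") (auto simp: le_max_iff_disj)
  moreover have "g (list_monom is cs) + h (list_monom is cs) = g (list_monom js cs) + h (list_monom js cs)"
    if "(\<forall>c\<in>set cs. 0 < c) \<and> length is = length cs \<and> length js = length cs \<and>
        sorted_wrt (<) is \<and> sorted_wrt (<) js" for "is" cs js
    using assms that unfolding quasisymmetric_def by metis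
  ultimately show ?thesis unfolding quasisymmetric_def by blast
qed

lemma quasisymmetric_cmult: "quasisymmetric h \<Longrightarrow> quasisymmetric (\<lambda>a. c * h a)"
  unfolding quasisymmetric_def by (metis mult_zero_right)

lemma quasisymmetric_sum:
  assumes "\<And>i. i \<in> I \<Longrightarrow> quasisymmetric (h i)"
  shows "quasisymmetric (\<lambda>a. \<Sum>i\<in>I. h i a)"
  using assms
  by (induction I rule: infinite_finite_induct) (auto intro: quasisymmetric_0 quasisymmetric_add)

typedef qsym = "{h. quasisymmetric h}" morphisms qcoeff Abs_qsym
  using quasisymmetric_0 by blast

setup_lifting type_definition_qsym

instantiation qsym :: ab_group_add
begin

lift_definition zero_qsym :: qsym is "\<lambda>_. 0" by (rule quasisymmetric_0)
lift_definition plus_qsym :: "qsym \<Rightarrow> qsym \<Rightarrow> qsym" is "\<lambda>g h a. g a + h a"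
  by (rule quasisymmetric_add)
lift_definition uminus_qsym :: "qsym \<Rightarrow> qsym" is "\<lambda>h a. - h a"
  using quasisymmetric_cmult[of _ "-1"] by simp
lift_definition minus_qsym :: "qsym \<Rightarrow> qsym \<Rightarrow> qsym" is "\<lambda>g h a. g a - h a"
  using quasisymmetric_add quasisymmetric_cmult[of _ "-1"] by fastforce

instance by standard (transfer; simp add: algebra_simps)+

end

section \<open>The quasisymmetric function of a matroid\<close>

definition monom_of :: "'a set \<Rightarrow> ('a \<Rightarrow> nat) \<Rightarrow> nat \<Rightarrow>\<^sub>0 nat" where
  "monom_of E f = (\<Sum>e\<in>E. Poly_Mapping.single (f e - 1) 1)"

definition matroid_series :: "'a set \<Rightarrow> 'a set set \<Rightarrow> (nat \<Rightarrow>\<^sub>0 nat) \<Rightarrow> int" where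
  "matroid_series E Bs a = int (card {f \<in> E \<rightarrow>\<^sub>E {1..}. generic Bs f \<and> monom_of E f = a})"

subsection \<open>Quasisymmetry\<close>

lemma lookup_monom_of:
  assumes "finite E" "f \<in> E \<rightarrow> {1..}"
  shows "Poly_Mapping.lookup (monom_of E f) i = card {e\<in>E. f e = Suc i}"
proof -
  have "Poly_Mapping.lookup (monom_of E f) i = (\<Sum>e\<in>E. if f e = Suc i then 1 else 0)"
    unfolding monom_of_def lookup_sum
  proof (rule sum.cong)
    fix e assume "e \<in> E"
    hence "f e \<ge> 1" using assms by auto
    thus "Poly_Mapping.lookup (Poly_Mapping.single (f e - 1) 1) i = (if f e = Suc i then 1 else (0::nat))"
      by (auto simp: lookup_single when_def)
  qed simp
  also have "\<dots> = card {e\<in>E. f e = Suc i}"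
    using assms by (simp add: sum.If_cases Int_def)
  finally show ?thesis .
qed

lemma in_keys_monom_of:
  assumes "finite E" "f \<in> E \<rightarrow> {1..}" "e \<in> E"
  shows "f e \<in> Suc ` Poly_Mapping.keys (monom_of E f)"
proof -
  have "f e = Suc (f e - 1)" using assms by force
  moreover from this have "Poly_Mapping.lookup (monom_of E f) (f e - 1) \<noteq> 0"
    using assms lookup_monom_of[OF assms(1,2), of "f e - 1"] by auto
  ultimately show ?thesis by (metis imageI in_keys_iff)
qed

lemma mdegree_monom_of:
  assumes "finite E" "f \<in> E \<rightarrow> {1..}"
  shows "mdegree (monom_of E f) = card E"
proof -
  let ?K = "Poly_Mapping.keys (monom_of E f)"
  have "mdegree (monom_of E f) = (\<Sum>i\<in>?K. card {e\<in>E. f e = Suc i})"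
    unfolding mdegree_def using lookup_monom_of[OF assms] by simp
  also have "\<dots> = card (\<Union>i\<in>?K. {e\<in>E. f e = Suc i})"
    by (rule card_UN_disjoint[symmetric]) (use assms in auto)
  also have "(\<Union>i\<in>?K. {e\<in>E. f e = Suc i}) = E"
    using in_keys_monom_of[OF assms] by auto
  finally show ?thesis .
qed

lemma finite_monom_of_fibre:
  assumes "finite E"
  shows "finite {f \<in> E \<rightarrow>\<^sub>E {1..}. P f \<and> monom_of E f = a}"
proof (rule finite_subset)
  show "{f \<in> E \<rightarrow>\<^sub>E {1..}. P f \<and> monom_of E f = a} \<subseteq> E \<rightarrow>\<^sub>E Suc ` Poly_Mapping.keys a"
  proof (intro subsetI)
    fix f assume "f \<in> {f \<in> E \<rightarrow>\<^sub>E {1..}. P f \<and> monom_of E f = a}"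
    hence f: "f \<in> E \<rightarrow>\<^sub>E {1..}" "monom_of E f = a" by auto
    hence "f \<in> E \<rightarrow> {1..}" by (auto simp: PiE_def)
    from in_keys_monom_of[OF assms this] f show "f \<in> E \<rightarrow>\<^sub>E Suc ` Poly_Mapping.keys a"
      by (simp add: PiE_iff)
  qed
  show "finite (E \<rightarrow>\<^sub>E Suc ` Poly_Mapping.keys a)" using assms by (intro finite_PiE) auto
qed

lemma sum_exchange:
  fixes f :: "'a \<Rightarrow> nat"
  assumes "finite B" "x \<in> B" "y \<notin> B"
  shows "sum f (insert y (B - {x})) + f x = sum f B + f y"
  using assms by (simp add: sum.remove[of B x])

text \<open>Genericity only depends on the order pattern of the weights, by a local optimality criterion.\<close>

lemma generic_iff_local:
  assumes M: "matroid_on E Bs"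
  shows "generic Bs f \<longleftrightarrow>
    (\<exists>B\<in>Bs. \<forall>x\<in>B. \<forall>y\<in>E - B. insert y (B - {x}) \<in> Bs \<longrightarrow> f x < f y)"
proof
  assume "generic Bs f"
  then obtain B where B: "B \<in> Bs" "\<forall>B'\<in>Bs. sum f B \<le> sum f B'"
    and uniq: "\<And>C. C \<in> Bs \<Longrightarrow> \<forall>B'\<in>Bs. sum f C \<le> sum f B' \<Longrightarrow> C = B"
    by (rule generic_obtain) blast
  have fin: "finite B" using M B(1) unfolding matroid_on_def by (meson finite_subset)
  have "f x < f y" if "x \<in> B" "y \<in> E - B" "insert y (B - {x}) \<in> Bs" for x y
  proof (rule ccontr)
    assume "\<not> f x < f y"
    with sum_exchange[OF fin that(1), of y f] that(2) have "sum f (insert y (B - {x})) \<le> sum f B"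
      by auto
    hence "insert y (B - {x}) = B"
      using uniq[OF that(3)] B(2) by (meson order_trans)
    thus False using that by blast
  qed
  with B(1) show "\<exists>B\<in>Bs. \<forall>x\<in>B. \<forall>y\<in>E - B. insert y (B - {x}) \<in> Bs \<longrightarrow> f x < f y" by blast
next
  assume "\<exists>B\<in>Bs. \<forall>x\<in>B. \<forall>y\<in>E - B. insert y (B - {x}) \<in> Bs \<longrightarrow> f x < f y"
  then obtain B where B: "B \<in> Bs"
    and loc: "\<And>x y. x \<in> B \<Longrightarrow> y \<in> E - B \<Longrightarrow> insert y (B - {x}) \<in> Bs \<Longrightarrow> f x < f y" by blast
  note sub = matroid_on_subset[OF M] and finE = matroid_on_finite[OF M]
  have ex: "\<And>B1 B2 x. B1 \<in> Bs \<Longrightarrow> B2 \<in> Bs \<Longrightarrow> x \<in> B1 - B2 \<Longrightarrow>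
               \<exists>y\<in>B2 - B1. insert y (B1 - {x}) \<in> Bs"
    using M unfolding matroid_on_def by blast
  have fin: "\<And>C. C \<in> Bs \<Longrightarrow> finite C" using sub finE finite_subset by blast
  have less: "C \<in> Bs \<Longrightarrow> C \<noteq> B \<Longrightarrow> sum f B < sum f C" for C
  proof (induction "card (C - B)" arbitrary: C rule: less_induct)
    case less
    let ?D = "(B - C) \<union> (C - B)"
    have D: "finite ?D" "?D \<noteq> {}" using fin B less.prems by auto
    obtain e where e: "e \<in> ?D" "\<And>u. u \<in> ?D \<Longrightarrow> f u \<le> f e"
    proof -
      have "Max (f ` ?D) \<in> f ` ?D" using D by (intro Max_in) auto
      then obtain e where e: "e \<in> ?D" "Max (f ` ?D) = f e" by auto
      have "f u \<le> f e" if "u \<in> ?D" for u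
        using Max_ge[of "f ` ?D" "f u"] D(1) that e(2) by auto
      with e(1) that show ?thesis by blast
    qed
    have notB: "u \<notin> B - C" if "f u = f e" for u
    proof
      assume u: "u \<in> B - C"
      from ex[OF B less.prems(1) u] obtain y where y: "y \<in> C - B" "insert y (B - {u}) \<in> Bs" by blast
      with loc[of u y] u sub[OF less.prems(1)] have "f u < f y" by blast
      with e(2)[of y] y that show False by auto
    qed
    hence eC: "e \<in> C - B" using e(1) by auto
    from ex[OF less.prems(1) B eC] obtain x where
      x: "x \<in> B - C" "insert x (C - {e}) \<in> Bs" by blast
    have lt: "f x < f e" using e(2)[of x] notB[of x] x by force
    let ?C = "insert x (C - {e})"
    have "sum f ?C < sum f C"
      using sum_exchange[OF fin[OF less.prems(1)], of e x f] eC x lt by auto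
    moreover have "sum f B \<le> sum f ?C"
    proof (cases "?C = B")
      case False
      have "?C - B = (C - B) - {e}" using x by auto
      hence "card (?C - B) < card (C - B)"
        using eC fin[OF less.prems(1)] by (metis card_Diff1_less finite_Diff)
      from less.hyps[OF this x(2) False] show ?thesis by simp
    qed simp
    ultimately show ?case by simp
  qed
  show "generic Bs f"
    unfolding generic_def
  proof (rule ex1I[of _ B])
    show "B \<in> Bs \<and> (\<forall>B'\<in>Bs. sum f B \<le> sum f B')" using B less by (metis less_imp_le order_refl)
    show "C = B" if "C \<in> Bs \<and> (\<forall>B'\<in>Bs. sum f C \<le> sum f B')" for C
      using that less[of C] B by (meson leD)
  qed
qed

lemma generic_mono_cong:
  assumes M: "matroid_on E Bs"
    and iff: "\<And>x y. x \<in> E \<Longrightarrow> y \<in> E \<Longrightarrow> f x < f y \<longleftrightarrow> g x < g y"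
  shows "generic Bs f \<longleftrightarrow> generic Bs g"
proof -
  note sub = matroid_on_subset[OF M]
  show ?thesis unfolding generic_iff_local[OF M]
    using sub iff by (intro bex_cong refl ball_cong imp_cong) auto
qed

lemma lookup_list_monom_nth:
  assumes "sorted_wrt (<) is" "length is = length cs" "t < length cs"
  shows "Poly_Mapping.lookup (list_monom is cs) (is ! t) = cs ! t"
proof -
  have d: "distinct is" using assms strict_sorted_iff by blast
  have "Poly_Mapping.lookup (list_monom is cs) (is ! t) =
      (\<Sum>s<length cs. if s = t then cs ! s else 0)"
    unfolding list_monom_def lookup_sum
  proof (rule sum.cong)
    fix s assume "s \<in> {..<length cs}"
    thus "Poly_Mapping.lookup (Poly_Mapping.single (is ! s) (cs ! s)) (is ! t) =
       (if s = t then cs ! s else 0)"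
      using d assms by (auto simp: lookup_single when_def nth_eq_iff_index_eq)
  qed simp
  thus ?thesis using assms by simp
qed

lemma lookup_list_monom_notin:
  assumes "length is = length cs" "i \<notin> set is"
  shows "Poly_Mapping.lookup (list_monom is cs) i = 0"
  unfolding list_monom_def lookup_sum
  using assms by (intro sum.neutral) (auto simp: lookup_single when_def)

lemma matroid_series_le:
  assumes M: "matroid_on E Bs"
    and I: "sorted_wrt (<) is" "length is = length cs"
    and J: "sorted_wrt (<) js" "length js = length cs"
  shows "matroid_series E Bs (list_monom is cs) \<le> matroid_series E Bs (list_monom js cs)"
proof -
  have fin: "finite E" using M by (simp add: matroid_on_def)
  have dI: "distinct is" and dJ: "distinct js" using I J strict_sorted_iff by blast+
  define pos where "pos i = (THE t. t < length cs \<and> is ! t = i)" for i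
  have pos: "pos (is ! t) = t" if "t < length cs" for t
    unfolding pos_def using that dI I(2) by (intro the_equality) (auto simp: nth_eq_iff_index_eq)
  define g where "g n = Suc (js ! pos (n - 1))" for n
  define T where "T f = restrict (g \<circ> f) E" for f :: "'a \<Rightarrow> nat"
  have g: "g (Suc (is ! t)) = Suc (js ! t)" if "t < length cs" for t
    by (simp add: g_def pos that)
  let ?A = "\<lambda>js. {f \<in> E \<rightarrow>\<^sub>E {1..}. generic Bs f \<and> monom_of E f = list_monom js cs}"
  have ex: "\<exists>t<length cs. f e = Suc (is ! t)" if fA: "f \<in> ?A is" and e: "e \<in> E" for f e
  proof -
    have f: "f \<in> E \<rightarrow> {1..}" "monom_of E f = list_monom is cs" using fA by (auto simp: PiE_def)
    obtain i where i: "f e = Suc i" "Poly_Mapping.lookup (list_monom is cs) i \<noteq> 0"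
      using in_keys_monom_of[OF fin f(1) e] f(2) by (metis imageE in_keys_iff)
    from i(2) have "i \<in> set is" using lookup_list_monom_notin[OF I(2), of i] by argo
    thus ?thesis using i I(2) by (auto simp: in_set_conv_nth)
  qed
  have lt: "is ! s < is ! t \<longleftrightarrow> js ! s < js ! t" if "s < length cs" "t < length cs" for s t
  proof -
    have "ks ! s < ks ! t \<longleftrightarrow> s < t" if "sorted_wrt (<) ks" "length ks = length cs" for ks :: "nat list"
    proof
      assume l: "ks ! s < ks ! t"
      show "s < t"
      proof (rule ccontr)
        assume "\<not> s < t"
        hence "t < s \<or> s = t" by linarith
        thus False using l sorted_wrt_nth_less[OF that(1), of t s] that(2) \<open>s < length cs\<close> by auto
      qed
    qed (use sorted_wrt_nth_less[OF that(1), of s t] that(2) \<open>t < length cs\<close> in simp)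
    with I J show ?thesis by blast
  qed
  have "card (?A is) \<le> card (?A js)"
  proof (rule card_inj_on_le[of T])
    show "finite (?A js)" using finite_monom_of_fibre[OF fin] by blast
    show "inj_on T (?A is)"
    proof (rule inj_onI)
      fix f h assume fh: "f \<in> ?A is" "h \<in> ?A is" "T f = T h"
      show "f = h"
      proof (rule PiE_ext)
        show "f \<in> E \<rightarrow>\<^sub>E {1..}" "h \<in> E \<rightarrow>\<^sub>E {1..}" using fh by auto
        fix e assume e: "e \<in> E"
        obtain s where s: "s < length cs" "f e = Suc (is ! s)" using ex[OF fh(1) e] by blast
        obtain t where t: "t < length cs" "h e = Suc (is ! t)" using ex[OF fh(2) e] by blast
        have "T f e = T h e" using fh(3) by simp
        hence "js ! s = js ! t" using e s t g unfolding T_def by simp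
        hence "s = t" using s t dJ J(2) by (auto simp: nth_eq_iff_index_eq)
        thus "f e = h e" using s t by simp
      qed
    qed
    show "T ` ?A is \<subseteq> ?A js"
    proof (intro subsetI, elim imageE, clarify)
      fix f assume "f \<in> E \<rightarrow>\<^sub>E {1..}" "generic Bs f" "monom_of E f = list_monom is cs"
      hence f: "f \<in> ?A is" by blast
      have f1: "f \<in> E \<rightarrow> {1..}" using f by (auto simp: PiE_def)
      have TE: "T f \<in> E \<rightarrow>\<^sub>E {1..}" by (auto simp: T_def g_def)
      have T1: "T f \<in> E \<rightarrow> {1..}" using TE by (auto simp: PiE_def)
      have "generic Bs f \<longleftrightarrow> generic Bs (T f)"
      proof (rule generic_mono_cong[OF M])
        fix x y assume xy: "x \<in> E" "y \<in> E"
        obtain s where s: "s < length cs" "f x = Suc (is ! s)" using ex[OF f xy(1)] by blast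
        obtain t where t: "t < length cs" "f y = Suc (is ! t)" using ex[OF f xy(2)] by blast
        show "f x < f y \<longleftrightarrow> T f x < T f y" using xy s t g lt by (simp add: T_def)
      qed
      moreover have "monom_of E (T f) = list_monom js cs"
      proof (rule poly_mapping_eqI)
        fix k
        show "Poly_Mapping.lookup (monom_of E (T f)) k = Poly_Mapping.lookup (list_monom js cs) k"
        proof (cases "k \<in> set js")
          case True
          then obtain t where t: "t < length cs" "k = js ! t" using J(2) by (metis in_set_conv_nth)
          have "{e\<in>E. T f e = Suc k} = {e\<in>E. f e = Suc (is ! t)}"
          proof (intro Collect_cong conj_cong refl)
            fix e assume e: "e \<in> E"
            obtain s where s: "s < length cs" "f e = Suc (is ! s)" using ex[OF f e] by blast
            show "T f e = Suc k \<longleftrightarrow> f e = Suc (is ! t)"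
              using e s t g dI dJ I(2) J(2) by (simp add: T_def nth_eq_iff_index_eq)
          qed
          hence "Poly_Mapping.lookup (monom_of E (T f)) k
              = Poly_Mapping.lookup (monom_of E f) (is ! t)"
            using lookup_monom_of[OF fin f1] lookup_monom_of[OF fin T1] by simp
          also have "\<dots> = cs ! t"
            using f lookup_list_monom_nth[OF I t(1)] by simp
          finally show ?thesis using lookup_list_monom_nth[OF J t(1)] t by simp
        next
          case False
          have "T f e \<noteq> Suc k" if "e \<in> E" for e
            using ex[OF f that] g that False J(2) by (auto simp: T_def)
          hence "{e\<in>E. T f e = Suc k} = {}" by blast
          hence "card {e\<in>E. T f e = Suc k} = 0" by (simp only: card.empty)
          thus ?thesis
            using lookup_monom_of[OF fin T1, of k] lookup_list_monom_notin[OF J(2) False] by (simp only:)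
        qed
      qed
      ultimately show "T f \<in> E \<rightarrow>\<^sub>E {1..} \<and> generic Bs (T f) \<and> monom_of E (T f) = list_monom js cs"
        using TE f by blast
    qed
  qed
  thus ?thesis by (simp add: matroid_series_def)
qed

lemma quasisymmetric_matroid_series:
  assumes M: "matroid_on E Bs"
  shows "quasisymmetric (matroid_series E Bs)"
  unfolding quasisymmetric_def
proof (intro conjI allI impI exI[of _ "card E"])
  have fin: "finite E" using M by (simp add: matroid_on_def)
  fix a assume "matroid_series E Bs a \<noteq> 0"
  then obtain f where "f \<in> E \<rightarrow>\<^sub>E {1..}" "monom_of E f = a"
    unfolding matroid_series_def by (force simp: card_eq_0_iff)
  thus "mdegree a \<le> card E" using mdegree_monom_of[OF fin, of f] by (auto simp: PiE_def)
next
  fix cs "is" js :: "nat list"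
  assume "(\<forall>c\<in>set cs. 0 < c) \<and> length is = length cs \<and> length js = length cs \<and>
          sorted_wrt (<) is \<and> sorted_wrt (<) js"
  thus "matroid_series E Bs (list_monom is cs) = matroid_series E Bs (list_monom js cs)"
    by (intro antisym matroid_series_le[OF M]) auto
qed

subsection \<open>Invariance under isomorphism\<close>

lemma generic_image:
  assumes sub: "\<And>B. B \<in> Bs \<Longrightarrow> B \<subseteq> E" and inj: "inj_on \<phi> E"
    and fg: "\<And>e. e \<in> E \<Longrightarrow> f e = g (\<phi> e)"
  shows "generic ((\<lambda>B. \<phi> ` B) ` Bs) g \<longleftrightarrow> generic Bs f"
proof -
  have s: "sum g (\<phi> ` B) = sum f B" if "B \<in> Bs" for B
  proof -
    have "sum g (\<phi> ` B) = sum (g \<circ> \<phi>) B"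
      using sub[OF that] inj by (intro sum.reindex) (rule inj_on_subset)
    also have "\<dots> = sum f B" using sub[OF that] fg by (intro sum.cong) auto
    finally show ?thesis .
  qed
  have i: "\<phi> ` B = \<phi> ` C \<longleftrightarrow> B = C" if "B \<in> Bs" "C \<in> Bs" for B C
    using sub that inj by (simp add: inj_on_image_eq_iff)
  let ?P = "\<lambda>B. \<forall>B'\<in>Bs. sum f B \<le> sum f B'"
  let ?Q = "\<lambda>C. \<forall>C'\<in>(\<lambda>B. \<phi> ` B) ` Bs. sum g C \<le> sum g C'"
  have PQ: "?Q (\<phi> ` B) \<longleftrightarrow> ?P B" if "B \<in> Bs" for B
    using s that by simp
  show ?thesis
  proof
    assume "generic Bs f"
    then obtain B where B: "B \<in> Bs" "?P B" and u: "\<And>C. C \<in> Bs \<Longrightarrow> ?P C \<Longrightarrow> C = B"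
      by (rule generic_obtain) blast
    show "generic ((\<lambda>B. \<phi> ` B) ` Bs) g"
      unfolding generic_def
    proof (rule ex1I[of _ "\<phi> ` B"])
      show "\<phi> ` B \<in> (\<lambda>B. \<phi> ` B) ` Bs \<and> ?Q (\<phi> ` B)" using B PQ by blast
      show "C = \<phi> ` B" if "C \<in> (\<lambda>B. \<phi> ` B) ` Bs \<and> ?Q C" for C
        using that PQ u by blast
    qed
  next
    assume "generic ((\<lambda>B. \<phi> ` B) ` Bs) g"
    then obtain C where C: "C \<in> (\<lambda>B. \<phi> ` B) ` Bs" "?Q C"
      and u: "\<And>D. D \<in> (\<lambda>B. \<phi> ` B) ` Bs \<Longrightarrow> ?Q D \<Longrightarrow> D = C"
      by (rule generic_obtain) blast
    then obtain B where B: "B \<in> Bs" "C = \<phi> ` B" by blast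
    show "generic Bs f"
      unfolding generic_def
    proof (rule ex1I[of _ B])
      show "B \<in> Bs \<and> ?P B" using B C PQ by blast
      show "D = B" if "D \<in> Bs \<and> ?P D" for D
        using that PQ[of D] u[of "\<phi> ` D"] i[of D B] B by blast
    qed
  qed
qed

lemma matroid_series_iso_le:
  assumes M: "matroid_on E Bs" and iso: "iso_matroids (E, Bs) (E', Bs')"
  shows "matroid_series E' Bs' a \<le> matroid_series E Bs a"
proof -
  from iso obtain \<phi> where \<phi>: "bij_betw \<phi> E E'" "Bs' = (\<lambda>B. \<phi> ` B) ` Bs"
    unfolding iso_matroids_def by auto
  note sub = matroid_on_subset[OF M] and fin = matroid_on_finite[OF M]
  have inj: "inj_on \<phi> E" and im: "E' = \<phi> ` E" using \<phi> by (auto simp: bij_betw_def)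
  let ?T = "\<lambda>g. restrict (g \<circ> \<phi>) E"
  have "card {f \<in> E' \<rightarrow>\<^sub>E {1..}. generic Bs' f \<and> monom_of E' f = a}
      \<le> card {f \<in> E \<rightarrow>\<^sub>E {1..}. generic Bs f \<and> monom_of E f = a}"
  proof (rule card_inj_on_le[of ?T])
    show "inj_on ?T {f \<in> E' \<rightarrow>\<^sub>E {1..}. generic Bs' f \<and> monom_of E' f = a}"
    proof (rule inj_onI, clarify)
      fix f g :: "'b \<Rightarrow> nat"
      assume fg: "f \<in> E' \<rightarrow>\<^sub>E {1..}" "g \<in> E' \<rightarrow>\<^sub>E {1..}" "?T f = ?T g"
      show "f = g"
      proof (rule PiE_ext[OF fg(1,2)])
        fix e assume "e \<in> E'"
        then obtain u where "u \<in> E" "e = \<phi> u" using im by auto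
        thus "f e = g e" using fun_cong[OF fg(3), of u] by simp
      qed
    qed
    show "?T ` {f \<in> E' \<rightarrow>\<^sub>E {1..}. generic Bs' f \<and> monom_of E' f = a}
        \<subseteq> {f \<in> E \<rightarrow>\<^sub>E {1..}. generic Bs f \<and> monom_of E f = a}"
    proof (intro subsetI, elim imageE, clarify)
      fix g :: "'b \<Rightarrow> nat"
      assume g: "g \<in> E' \<rightarrow>\<^sub>E {1..}" "generic Bs' g"
      have "?T g \<in> E \<rightarrow>\<^sub>E {1..}" using g im by (auto simp: PiE_iff)
      moreover have "generic Bs (?T g)"
        using generic_image[OF sub inj, where f = "?T g" and g = g] g \<phi>(2) by simp
      moreover have "monom_of E (?T g) = monom_of E' g"
        unfolding monom_of_def im using inj by (subst sum.reindex) (auto intro: sum.cong)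
      ultimately show "?T g \<in> E \<rightarrow>\<^sub>E {1..} \<and> generic Bs (?T g) \<and> monom_of E (?T g) = monom_of E' g"
        by blast
    qed
    show "finite {f \<in> E \<rightarrow>\<^sub>E {1..}. generic Bs f \<and> monom_of E f = a}"
      by (rule finite_monom_of_fibre[OF fin])
  qed
  thus ?thesis by (simp add: matroid_series_def)
qed

lemma matroid_series_iso:
  assumes "matroid_on E Bs" "matroid_on E' Bs'" "iso_matroids (E, Bs) (E', Bs')"
  shows "matroid_series E Bs = matroid_series E' Bs'"
proof (intro ext antisym)
  fix a
  show "matroid_series E' Bs' a \<le> matroid_series E Bs a"
    by (rule matroid_series_iso_le[OF assms(1,3)])
  have "iso_matroids (E', Bs') (E, Bs)"
    using iso_matroids_sym[OF assms(3)] matroid_on_subset[OF assms(1)] by simp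
  thus "matroid_series E Bs a \<le> matroid_series E' Bs' a"
    by (rule matroid_series_iso_le[OF assms(2)])
qed

lift_definition matroid_qsym :: "matroid \<Rightarrow> qsym" is "\<lambda>(E, Bs). matroid_series E Bs"
  by (auto intro: quasisymmetric_matroid_series)

lift_definition class_qsym :: "matroid_class \<Rightarrow> qsym" is matroid_qsym
  by transfer (auto intro: matroid_series_iso)

lift_definition mat_qsym :: "mat \<Rightarrow> qsym" is
  "\<lambda>m a. \<Sum>c\<in>Poly_Mapping.keys m. Poly_Mapping.lookup m c * qcoeff (class_qsym c) a"
  using qcoeff by (intro quasisymmetric_sum quasisymmetric_cmult) blast

lemma mat_qsym_frag_of: "mat_qsym (frag_of c) = class_qsym c"
  by (simp add: qcoeff_inject[symmetric] mat_qsym.rep_eq)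

lemma mat_qsym_add: "mat_qsym (m + n) = mat_qsym m + mat_qsym n"
proof -
  have *: "qcoeff (mat_qsym m) a = (\<Sum>c\<in>K. Poly_Mapping.lookup m c * qcoeff (class_qsym c) a)"
    if "finite K" "Poly_Mapping.keys m \<subseteq> K" for m a K
    unfolding mat_qsym.rep_eq
    using that by (intro sum.mono_neutral_left) (auto simp: in_keys_iff)
  let ?K = "Poly_Mapping.keys m \<union> Poly_Mapping.keys n"
  have "qcoeff (mat_qsym (m + n)) a = qcoeff (mat_qsym m) a + qcoeff (mat_qsym n) a" for a
    using Poly_Mapping.keys_add[of m n]
    by (simp add: *[of ?K] lookup_add algebra_simps sum.distrib)
  thus ?thesis by (simp add: qcoeff_inject[symmetric] plus_qsym.rep_eq fun_eq_iff)
qed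

section \<open>Tensor products of abelian groups\<close>

text \<open>
  \<open>A \<otimes> B\<close> is the free abelian group on \<open>A \<times> B\<close> modulo the subgroup generated by the
  bilinearity relations.
\<close>

inductive_set tensor_rel :: "(('a::ab_group_add \<times> 'b::ab_group_add) \<Rightarrow>\<^sub>0 int) set" where
  zero: "0 \<in> tensor_rel"
| diff: "r \<in> tensor_rel \<Longrightarrow> s \<in> tensor_rel \<Longrightarrow> r - s \<in> tensor_rel"
| left: "frag_of (a + a', b) - frag_of (a, b) - frag_of (a', b) \<in> tensor_rel"
| right: "frag_of (a, b + b') - frag_of (a, b) - frag_of (a, b') \<in> tensor_rel"

definition tensor_eq ::
  "(('a::ab_group_add \<times> 'b::ab_group_add) \<Rightarrow>\<^sub>0 int) \<Rightarrow> (('a \<times> 'b) \<Rightarrow>\<^sub>0 int) \<Rightarrow> bool" where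
  "tensor_eq u v \<longleftrightarrow> u - v \<in> tensor_rel"

lemma tensor_rel_minus: "r \<in> tensor_rel \<Longrightarrow> - r \<in> tensor_rel"
  using tensor_rel.diff[OF tensor_rel.zero] by fastforce

lemma tensor_rel_add: "r \<in> tensor_rel \<Longrightarrow> s \<in> tensor_rel \<Longrightarrow> r + s \<in> tensor_rel"
  using tensor_rel.diff[OF _ tensor_rel_minus] by fastforce

quotient_type (overloaded) ('a, 'b) tensor = "('a::ab_group_add \<times> 'b::ab_group_add) \<Rightarrow>\<^sub>0 int" / tensor_eq
proof (rule equivpI)
  show "reflp tensor_eq" by (rule reflpI) (simp add: tensor_eq_def tensor_rel.zero)
  show "symp tensor_eq"
    by (rule sympI) (metis tensor_eq_def tensor_rel_minus minus_diff_eq)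
  show "transp tensor_eq"
  proof (rule transpI)
    fix u v w assume "tensor_eq u v" "tensor_eq v w"
    hence "(u - v) + (v - w) \<in> tensor_rel" unfolding tensor_eq_def by (rule tensor_rel_add)
    thus "tensor_eq u w" by (simp add: tensor_eq_def)
  qed
qed

instantiation tensor :: (ab_group_add, ab_group_add) ab_group_add
begin

lift_definition zero_tensor :: "('a, 'b) tensor" is 0 .
lift_definition plus_tensor :: "('a, 'b) tensor \<Rightarrow> ('a, 'b) tensor \<Rightarrow> ('a, 'b) tensor" is "(+)"
  unfolding tensor_eq_def add_diff_add by (rule tensor_rel_add)
lift_definition uminus_tensor :: "('a, 'b) tensor \<Rightarrow> ('a, 'b) tensor" is uminus
  unfolding tensor_eq_def minus_diff_minus by (rule tensor_rel_minus)
lift_definition minus_tensor :: "('a, 'b) tensor \<Rightarrow> ('a, 'b) tensor \<Rightarrow> ('a, 'b) tensor" is "(-)"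
proof -
  fix u v w z :: "('a \<times> 'b) \<Rightarrow>\<^sub>0 int" assume "tensor_eq u v" "tensor_eq w z"
  hence "(u - v) - (w - z) \<in> tensor_rel" unfolding tensor_eq_def by (rule tensor_rel.diff)
  thus "tensor_eq (u - w) (v - z)" by (simp add: tensor_eq_def algebra_simps)
qed

instance
  by standard (transfer; simp add: tensor_eq_def tensor_rel.zero algebra_simps)+

end

lift_definition pure_tensor :: "'a::ab_group_add \<Rightarrow> 'b::ab_group_add \<Rightarrow> ('a, 'b) tensor"
  (infixl \<open>\<otimes>\<^sub>t\<close> 70) is "\<lambda>a b. frag_of (a, b)" .

lemma pure_tensor_add_left: "(a + a') \<otimes>\<^sub>t b = a \<otimes>\<^sub>t b + a' \<otimes>\<^sub>t b"
  by transfer (simp only: tensor_eq_def diff_diff_eq[symmetric] tensor_rel.left)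

lemma pure_tensor_add_right: "a \<otimes>\<^sub>t (b + b') = a \<otimes>\<^sub>t b + a \<otimes>\<^sub>t b'"
  by transfer (simp only: tensor_eq_def diff_diff_eq[symmetric] tensor_rel.right)

lemma tensor_rel_extend:
  assumes add: "\<And>x y. h (x + y) = h x + h y" and r: "r \<in> tensor_rel"
  shows "frag_extend (\<lambda>(a, b). frag_of (h a, b)) r \<in> tensor_rel"
  using r
proof induction
  case zero
  show ?case by (simp add: tensor_rel.zero)
next
  case (diff r s)
  thus ?case by (simp add: frag_extend_diff tensor_rel.diff)
next
  case (left a a' b)
  show ?case by (simp add: frag_extend_diff add tensor_rel.left)
next
  case (right a b b')
  show ?case by (simp add: frag_extend_diff tensor_rel.right)
qed

text \<open>The map \<open>F \<otimes> id\<close>, sending \<open>m \<otimes> c\<close> to \<open>F(m) \<otimes> c\<close>.\<close>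

lift_definition mat_qsym_tensor :: "(mat, 'k::ab_group_add) tensor \<Rightarrow> (qsym, 'k) tensor" is
  "frag_extend (\<lambda>(m, c). frag_of (mat_qsym m, c))"
  unfolding tensor_eq_def frag_extend_diff[symmetric]
  by (rule tensor_rel_extend[where h = mat_qsym, OF mat_qsym_add])

lemma mat_qsym_tensor_pure: "mat_qsym_tensor (m \<otimes>\<^sub>t c) = mat_qsym m \<otimes>\<^sub>t c"
  by transfer (simp add: tensor_eq_def tensor_rel.zero)

lemma mat_qsym_tensor_add: "mat_qsym_tensor (u + v) = mat_qsym_tensor u + mat_qsym_tensor v"
  by transfer (simp add: tensor_eq_def tensor_rel.zero frag_extend_add)

end

theory Submission
  imports Defs "HOL-Combinatorics.Permutations"
begin

text \<open>
  Let \<open>a\<close> be a monomial of degree \<open>n\<close> and \<open>\<beta>\<close> the weakly increasing word with content \<open>a\<close>.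
  A weight with content \<open>a\<close> is generic iff it has a locally optimal base, and refining its ties so that
  elements outside the base come first turns it into total orders of the ground set.  Hence the
  coefficient of \<open>a\<close> depends linearly on the numbers \<open>g\<^sub>W\<close> of total orders whose greedy base
  occupies the positions \<open>W \<subseteq> {..<n}\<close>: up to the factor \<open>card (stabilizer n \<beta>)\<close> it is the sum of
  \<open>g\<^sub>V\<close> with \<open>V = sift n \<beta> W\<close> over all \<open>W\<close>.

  For the Schubert matroid of \<open>W\<close> only \<open>g\<^sub>V\<close> with \<open>V\<close> dominating \<open>W\<close> are non-zero, and \<open>g\<^sub>W > 0\<close>.
  So rational combinations of matroids realise every prescribed family \<open>g\<close>.  Taking
  \<open>g\<^sub>W = (-1) ^ card W\<close> for \<open>U \<subseteq> W\<close> and \<open>0\<close> otherwise, the resulting quasisymmetric function vanishes at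
  \<open>a\<close> unless every fibre of \<open>\<beta>\<close> meets \<open>U\<close>, and it does not vanish if \<open>U\<close> consists of the last
  positions of the fibres.  This is triangular with respect to the monomial basis.
\<close>

section \<open>Local optima and orderings\<close>

definition local_opt :: "'a set \<Rightarrow> 'a set set \<Rightarrow> ('a \<Rightarrow> nat) \<Rightarrow> 'a set \<Rightarrow> bool" where
  "local_opt E Bs f B \<longleftrightarrow>
     B \<in> Bs \<and> (\<forall>x\<in>B. \<forall>y\<in>E - B. insert y (B - {x}) \<in> Bs \<longrightarrow> f x < f y)"

lemma generic_iff_local_opt:
  "matroid_on E Bs \<Longrightarrow> generic Bs f \<longleftrightarrow> (\<exists>B. local_opt E Bs f B)"
  by (auto simp: generic_iff_local local_opt_def)

lemma local_opt_cong:
  assumes "matroid_on E Bs" "\<And>e. e \<in> E \<Longrightarrow> f e = g e"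
  shows "local_opt E Bs f B \<longleftrightarrow> local_opt E Bs g B"
proof (cases "B \<in> Bs")
  case True
  hence "B \<subseteq> E" using matroid_on_subset[OF assms(1)] by blast
  thus ?thesis unfolding local_opt_def using assms(2) by (smt (verit) DiffD1 in_mono)
qed (simp add: local_opt_def)

text \<open>Take \<open>e\<close> of maximal weight in the symmetric difference. Exchanging it out
  of the optimum that contains it brings in an element of the other one, which local optimality
  forces to be strictly heavier.\<close>

lemma local_opt_unique:
  assumes M: "matroid_on E Bs" and B: "local_opt E Bs f B" and C: "local_opt E Bs f C"
  shows "B = C"
proof (rule ccontr)
  assume "B \<noteq> C"
  let ?D = "(B - C) \<union> (C - B)"
  have "B \<subseteq> E" "C \<subseteq> E" using M B C unfolding local_opt_def matroid_on_def by auto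
  hence "finite ?D" using M by (meson finite_Diff finite_UnI finite_subset matroid_on_finite)
  moreover have "?D \<noteq> {}" using \<open>B \<noteq> C\<close> by blast
  ultimately obtain e where e: "e \<in> ?D" "\<And>u. u \<in> ?D \<Longrightarrow> f u \<le> f e"
    using Max_in[of "f ` ?D"] Max_ge[of "f ` ?D"] by (smt (verit) finite_imageI image_iff image_is_empty)
  have no: False if X: "local_opt E Bs f X" and Y: "local_opt E Bs f Y" and eX: "e \<in> X - Y"
      and D: "Y - X \<subseteq> ?D" for X Y
  proof -
    have XY: "X \<in> Bs" "Y \<in> Bs" using X Y by (auto simp: local_opt_def)
    obtain y where y: "y \<in> Y - X" "insert y (X - {e}) \<in> Bs"
      using M XY eX unfolding matroid_on_def by meson
    hence "y \<in> E - X" using matroid_on_subset[OF M XY(2)] by blast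
    hence "f e < f y" using X eX y unfolding local_opt_def by blast
    thus False using e(2)[of y] y(1) D by fastforce
  qed
  from e(1) show False using no[OF B C] no[OF C B] by blast
qed

section \<open>Counting generic weights by orders of the ground set\<close>

definition stabilizer :: "nat \<Rightarrow> (nat \<Rightarrow> nat) \<Rightarrow> (nat \<Rightarrow> nat) set" where
  "stabilizer n \<beta> = {q. q permutes {..<n} \<and> (\<forall>i<n. \<beta> (q i) = \<beta> i)}"

lemma card_stabilizer_pos: "card (stabilizer n \<beta>) > 0"
proof -
  have "finite (stabilizer n \<beta>)"
    unfolding stabilizer_def by (rule finite_subset[OF _ finite_permutations[of "{..<n}"]]) auto
  moreover have "id \<in> stabilizer n \<beta>" by (simp add: stabilizer_def permutes_id)
  ultimately show ?thesis by (auto simp: card_gt_0_iff)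
qed

text \<open>
  For \<open>\<beta> = id\<close> these are the total orders \<open>p 0, \<dots>, p (n - 1)\<close> of the ground set whose greedy base
  occupies exactly the positions \<open>W\<close>.
\<close>

definition orderings :: "nat \<Rightarrow> nat set set \<Rightarrow> (nat \<Rightarrow> nat) \<Rightarrow> nat set \<Rightarrow> (nat \<Rightarrow> nat) set" where
  "orderings n Bs \<beta> W = {p. p permutes {..<n} \<and> local_opt {..<n} Bs (\<beta> \<circ> inv p) (p ` W)}"

lemma finite_orderings: "finite (orderings n Bs \<beta> W)"
  unfolding orderings_def by (rule finite_subset[OF _ finite_permutations[of "{..<n}"]]) auto

lemma permutes_of_fibre_cards:
  assumes "finite A" "\<And>x. card {i\<in>A. f i = x} = card {i\<in>A. g i = x}"
  shows "\<exists>p. p permutes A \<and> (\<forall>i\<in>A. f i = g (p i))"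
proof -
  have "image_mset f (mset_set A) = image_mset g (mset_set A)"
  proof (rule multiset_eqI)
    fix x
    have "count (image_mset h (mset_set A)) x = card {i\<in>A. h i = x}" for h :: "'a \<Rightarrow> 'b"
      using assms(1) by (simp add: count_image_mset vimage_def Int_def conj_commute)
    thus "count (image_mset f (mset_set A)) x = count (image_mset g (mset_set A)) x"
      using assms(2) by simp
  qed
  from image_mset_eq_implies_permutes[OF assms(1) this] show ?thesis by blast
qed

lemma permutes_of_monom_of_eq:
  assumes fin: "finite E" and f: "f \<in> E \<rightarrow> {1..}" and g: "g \<in> E \<rightarrow> {1..}"
    and eq: "monom_of E f = monom_of E g"
  shows "\<exists>p. p permutes E \<and> (\<forall>i\<in>E. f i = g (p i))"
proof (rule permutes_of_fibre_cards[OF fin])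
  fix x
  show "card {i\<in>E. f i = x} = card {i\<in>E. g i = x}"
  proof (cases x)
    case 0
    have "{i\<in>E. f i = 0} = {}" "{i\<in>E. g i = 0} = {}" using f g by (fastforce simp: Pi_iff)+
    thus ?thesis by (simp only: 0)
  next
    case (Suc k)
    thus ?thesis using lookup_monom_of[OF fin f, of k] lookup_monom_of[OF fin g, of k] eq by simp
  qed
qed

lemma monom_of_permute:
  assumes "p permutes E" "\<And>e. e \<in> E \<Longrightarrow> f e = g (p e)"
  shows "monom_of E f = monom_of E g"
proof -
  have "monom_of E f = (\<Sum>e\<in>E. Poly_Mapping.single (g (p e) - 1) 1)"
    unfolding monom_of_def using assms(2) by (intro sum.cong) auto
  also have "\<dots> = monom_of E g"
    unfolding monom_of_def using sum.permute[OF assms(1), of "\<lambda>e. Poly_Mapping.single (g e - 1) (1::nat)"]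
    by (simp add: comp_def)
  finally show ?thesis .
qed

text \<open>Double counting of the permutations \<open>p\<close> for which
  \<open>\<beta> \<circ> inv p\<close> is generic. Grouped by the induced weight, each group is a
  coset of the stabilizer; grouped by the positions of the unique local optimum, the groups are the
  sets \<open>orderings n Bs \<beta> W\<close>.\<close>

lemma matroid_series_orderings:
  assumes M: "matroid_on {..<n} Bs" and \<beta>: "\<beta> \<in> {..<n} \<rightarrow> {1..}"
  shows "int (card (stabilizer n \<beta>)) * matroid_series {..<n} Bs (monom_of {..<n} \<beta>) =
    int (\<Sum>W\<in>Pow {..<n}. card (orderings n Bs \<beta> W))"
proof -
  let ?E = "{..<n}"
  define A where "A = {f \<in> ?E \<rightarrow>\<^sub>E {1..}. generic Bs f \<and> monom_of ?E f = monom_of ?E \<beta>}"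
  define P where "P = {p. p permutes ?E \<and> generic Bs (\<beta> \<circ> inv p)}"
  have finA: "finite A" unfolding A_def by (rule finite_monom_of_fibre) simp
  have finP: "finite P"
    unfolding P_def by (rule finite_subset[OF _ finite_permutations[of ?E]]) auto
  \<comment> \<open>The restriction only normalises values outside the ground set, so that
    \<open>t p\<close> lies in the function space that \<open>matroid_series\<close> counts.\<close>
  define t where "t p = restrict (\<beta> \<circ> inv p) ?E" for p
  have gen_t: "generic Bs (t p) \<longleftrightarrow> generic Bs (\<beta> \<circ> inv p)" for p
    unfolding t_def by (rule generic_mono_cong[OF M]) simp
  have tA: "t p \<in> A" if "p \<in> P" for p
  proof -
    have p: "p permutes ?E" using that by (simp add: P_def)
    have i: "inv p permutes ?E" by (rule permutes_inv[OF p])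
    have "t p \<in> ?E \<rightarrow>\<^sub>E {1..}" using \<beta> permutes_in_image[OF i] by (auto simp: t_def)
    moreover have "monom_of ?E (t p) = monom_of ?E \<beta>"
      by (rule monom_of_permute[OF i]) (simp add: t_def)
    ultimately show ?thesis using that gen_t by (simp add: A_def P_def)
  qed
  have fibre: "card {p\<in>P. t p = f} = card (stabilizer n \<beta>)" if f: "f \<in> A" for f
  proof -
    have "f \<in> ?E \<rightarrow> {1..}" using f by (auto simp: A_def PiE_def)
    \<comment> \<open>Equal content supplies one preimage \<open>p0\<close>; every other preimage
      differs from it by a permutation of positions that preserves \<beta>.\<close>
    with f \<beta> obtain p0 where p0: "p0 permutes ?E" "\<And>i. i < n \<Longrightarrow> \<beta> i = f (p0 i)"
      using permutes_of_monom_of_eq[of ?E \<beta> f] by (auto simp: A_def)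
    have i0: "inv p0 permutes ?E" by (rule permutes_inv[OF p0(1)])
    have "bij_betw (\<lambda>q. p0 \<circ> inv q) (stabilizer n \<beta>) {p\<in>P. t p = f}"
    proof (rule bij_betw_byWitness[where f' = "\<lambda>p. inv p \<circ> p0"])
      show "\<forall>q\<in>stabilizer n \<beta>. inv (p0 \<circ> inv q) \<circ> p0 = q"
      proof
        fix q assume "q \<in> stabilizer n \<beta>"
        hence q: "q permutes ?E" by (simp add: stabilizer_def)
        have "inv (p0 \<circ> inv q) = q \<circ> inv p0"
          using p0(1) q permutes_inv[OF q]
          by (metis o_inv_distrib permutes_bij permutes_inv_inv)
        thus "inv (p0 \<circ> inv q) \<circ> p0 = q"
          using p0(1) by (simp add: comp_assoc permutes_inv_o)
      qed
      show "\<forall>p\<in>{p\<in>P. t p = f}. p0 \<circ> inv (inv p \<circ> p0) = p"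
      proof
        fix p assume "p \<in> {p\<in>P. t p = f}"
        hence p: "p permutes ?E" by (simp add: P_def)
        have "inv (inv p \<circ> p0) = inv p0 \<circ> p"
          using p0(1) p permutes_inv[OF p]
          by (metis o_inv_distrib permutes_bij permutes_inv_inv)
        thus "p0 \<circ> inv (inv p \<circ> p0) = p"
          using p0(1) by (simp add: comp_assoc[symmetric] permutes_inv_o)
      qed
      show "(\<lambda>q. p0 \<circ> inv q) ` stabilizer n \<beta> \<subseteq> {p\<in>P. t p = f}"
      proof (intro image_subsetI CollectI conjI)
        fix q assume "q \<in> stabilizer n \<beta>"
        hence q: "q permutes ?E" "\<And>i. i < n \<Longrightarrow> \<beta> (q i) = \<beta> i" by (auto simp: stabilizer_def)
        have pm: "p0 \<circ> inv q permutes ?E" by (rule permutes_compose[OF permutes_inv[OF q(1)] p0(1)])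
        have iv: "inv (p0 \<circ> inv q) = q \<circ> inv p0"
          using p0(1) q(1) permutes_inv[OF q(1)]
          by (metis o_inv_distrib permutes_bij permutes_inv_inv)
        show tf: "t (p0 \<circ> inv q) = f"
        proof
          fix e
          show "t (p0 \<circ> inv q) e = f e"
          proof (cases "e < n")
            case True
            hence "inv p0 e < n" using permutes_in_image[OF i0] by auto
            thus ?thesis using True q(2) p0(2) permutes_inverses(1)[OF p0(1)] by (simp add: t_def iv)
          next
            case False
            thus ?thesis using f by (auto simp: t_def A_def PiE_def extensional_def)
          qed
        qed
        show "p0 \<circ> inv q \<in> P"
          using pm gen_t[of "p0 \<circ> inv q"] f unfolding tf by (simp add: P_def A_def)
      qed
      show "(\<lambda>p. inv p \<circ> p0) ` {p\<in>P. t p = f} \<subseteq> stabilizer n \<beta>"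
      proof (intro image_subsetI)
        fix p assume "p \<in> {p\<in>P. t p = f}"
        hence p: "p permutes ?E" "t p = f" by (auto simp: P_def)
        have "\<beta> (inv p (p0 i)) = \<beta> i" if "i < n" for i
          using fun_cong[OF p(2), of "p0 i"] permutes_in_image[OF p0(1), of i] that p0(2)
          by (simp add: t_def)
        thus "inv p \<circ> p0 \<in> stabilizer n \<beta>"
          using permutes_compose[OF p0(1) permutes_inv[OF p(1)]] by (simp add: stabilizer_def)
      qed
    qed
    from bij_betw_same_card[OF this] show ?thesis by simp
  qed
  have "card P = card (\<Union>f\<in>A. {p\<in>P. t p = f})"
    by (rule arg_cong[where f = card]) (use tA in auto)
  also have "\<dots> = (\<Sum>f\<in>A. card {p\<in>P. t p = f})"
    by (rule card_UN_disjoint) (use finA finP in auto)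
  also have "\<dots> = card A * card (stabilizer n \<beta>)" using fibre by simp
  finally have 1: "card P = card A * card (stabilizer n \<beta>)" .
  have "P = (\<Union>W\<in>Pow ?E. orderings n Bs \<beta> W)"
  proof (intro set_eqI iffI)
    fix p assume "p \<in> P"
    hence p: "p permutes ?E" and "generic Bs (\<beta> \<circ> inv p)" by (auto simp: P_def)
    then obtain B where B: "local_opt ?E Bs (\<beta> \<circ> inv p) B" using generic_iff_local_opt[OF M] by blast
    hence "B \<subseteq> ?E" using matroid_on_subset[OF M] by (simp add: local_opt_def)
    hence "inv p ` B \<in> Pow ?E" using permutes_image[OF permutes_inv[OF p]] by blast
    moreover have "p ` inv p ` B = B" using permutes_inv_o(1)[OF p] by (simp add: image_comp)
    ultimately show "p \<in> (\<Union>W\<in>Pow ?E. orderings n Bs \<beta> W)"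
      using p B unfolding orderings_def by (intro UN_I[of "inv p ` B"]) auto
  qed (use generic_iff_local_opt[OF M] in \<open>auto simp: P_def orderings_def\<close>)
  also have "card \<dots> = (\<Sum>W\<in>Pow ?E. card (orderings n Bs \<beta> W))"
  proof (rule card_UN_disjoint, simp, simp add: finite_orderings, intro ballI impI)
    fix W W' assume W: "W \<in> Pow ?E" "W' \<in> Pow ?E" "W \<noteq> W'"
    have False if "p \<in> orderings n Bs \<beta> W" "p \<in> orderings n Bs \<beta> W'" for p
    proof -
      have "p ` W = p ` W'"
        using local_opt_unique[OF M, of "\<beta> \<circ> inv p" "p ` W" "p ` W'"] that
        by (simp add: orderings_def)
      moreover have "inj p" using that permutes_inj by (auto simp: orderings_def)
      ultimately show False using W by (simp add: inj_image_eq_iff)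
    qed
    thus "orderings n Bs \<beta> W \<inter> orderings n Bs \<beta> W' = {}" by blast
  qed
  finally have 2: "card P = (\<Sum>W\<in>Pow ?E. card (orderings n Bs \<beta> W))" .
  have "matroid_series ?E Bs (monom_of ?E \<beta>) = int (card A)"
    by (simp add: matroid_series_def A_def)
  thus ?thesis unfolding 2[symmetric] 1 by simp
qed

section \<open>Sifting positions within fibres\<close>

text \<open>
  Push the elements of \<open>W\<close> to the end of each fibre of \<open>\<beta>\<close>.  For weakly increasing \<open>\<beta>\<close>, a local
  optimum on a sifted position set does not see whether positions are compared by \<open>\<beta>\<close> or by \<open><\<close>.
\<close>

definition sift :: "nat \<Rightarrow> (nat \<Rightarrow> nat) \<Rightarrow> nat set \<Rightarrow> nat set" where
  "sift n \<beta> W = {i. i < n \<and> card {j. i \<le> j \<and> j < n \<and> \<beta> j = \<beta> i} \<le> card {j\<in>W. \<beta> j = \<beta> i}}"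

lemma sift_subset: "sift n \<beta> W \<subseteq> {..<n}"
  by (auto simp: sift_def)

lemma sift_upward:
  assumes "i \<in> sift n \<beta> W" "i < j" "j < n" "\<beta> j = \<beta> i"
  shows "j \<in> sift n \<beta> W"
proof -
  have "card {l. j \<le> l \<and> l < n \<and> \<beta> l = \<beta> j} \<le> card {l. i \<le> l \<and> l < n \<and> \<beta> l = \<beta> i}"
    using assms by (intro card_mono) auto
  thus ?thesis using assms by (auto simp: sift_def)
qed

text \<open>Counting from the top, \<open>t\<close> ranks the elements of \<open>I\<close>
  bijectively by \<open>1, ..., card I\<close>, so exactly \<open>k\<close> of them have rank at
  most \<open>k\<close>.\<close>

lemma card_final_segment:
  fixes I :: "nat set"
  assumes fin: "finite I" and k: "k \<le> card I"
  shows "card {i\<in>I. card {j\<in>I. i \<le> j} \<le> k} = k"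
proof -
  define t where "t i = card {j\<in>I. i \<le> j}" for i
  have less: "t j < t i" if "i < j" "i \<in> I" for i j
  proof -
    have "{l\<in>I. j \<le> l} \<subset> {l\<in>I. i \<le> l}" using that by (auto simp: psubset_eq set_eq_iff intro!: exI[of _ i])
    thus ?thesis unfolding t_def using fin by (intro psubset_card_mono) auto
  qed
  have inj: "inj_on t I"
    by (rule linorder_inj_onI) (use less in fastforce)+
  have "t ` I \<subseteq> {1..card I}"
  proof (intro image_subsetI)
    fix i assume "i \<in> I"
    hence "{i} \<subseteq> {j\<in>I. i \<le> j}" by simp
    hence "card {i} \<le> t i" unfolding t_def by (rule card_mono[rotated]) (use fin in simp)
    moreover have "t i \<le> card I" unfolding t_def by (rule card_mono) (use fin in auto)
    ultimately show "t i \<in> {1..card I}" by simp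
  qed
  hence im: "t ` I = {1..card I}"
    using card_image[OF inj] by (intro card_subset_eq) auto
  have "card {i\<in>I. t i \<le> k} = card (t ` {i\<in>I. t i \<le> k})"
    using inj by (intro card_image[symmetric]) (auto intro: inj_on_subset)
  also have "t ` {i\<in>I. t i \<le> k} = {1..k}"
  proof (intro set_eqI iffI)
    fix x assume x: "x \<in> {1..k}"
    hence "x \<in> t ` I" unfolding im using k by simp
    thus "x \<in> t ` {i\<in>I. t i \<le> k}" using x by auto
  qed (use im in auto)
  finally show ?thesis by (simp add: t_def)
qed

lemma card_sift_fibre:
  assumes W: "W \<subseteq> {..<n}"
  shows "card {i \<in> sift n \<beta> W. \<beta> i = v} = card {i\<in>W. \<beta> i = v}"
proof -
  let ?I = "{i. i < n \<and> \<beta> i = v}"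
  have "card {i\<in>W. \<beta> i = v} \<le> card ?I" using W by (intro card_mono) auto
  from card_final_segment[OF _ this]
  have "card {i\<in>?I. card {j\<in>?I. i \<le> j} \<le> card {i\<in>W. \<beta> i = v}} = card {i\<in>W. \<beta> i = v}" by simp
  moreover have "{i\<in>?I. card {j\<in>?I. i \<le> j} \<le> card {i\<in>W. \<beta> i = v}} = {i \<in> sift n \<beta> W. \<beta> i = v}"
  proof (intro set_eqI iffI; clarsimp simp: sift_def)
    fix i assume "i < n" "card {j. j < n \<and> \<beta> j = \<beta> i \<and> i \<le> j} \<le> card {j\<in>W. \<beta> j = \<beta> i}"
    moreover have "{j. j < n \<and> \<beta> j = \<beta> i \<and> i \<le> j} = {j. i \<le> j \<and> j < n \<and> \<beta> j = \<beta> i}" by auto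
    ultimately show "card {j. i \<le> j \<and> j < n \<and> \<beta> j = \<beta> i} \<le> card {j\<in>W. \<beta> j = \<beta> i}" by simp
  next
    fix i assume "i < n" "card {j. i \<le> j \<and> j < n \<and> \<beta> j = \<beta> i} \<le> card {j\<in>W. \<beta> j = \<beta> i}"
    moreover have "{j. j < n \<and> \<beta> j = \<beta> i \<and> i \<le> j} = {j. i \<le> j \<and> j < n \<and> \<beta> j = \<beta> i}" by auto
    ultimately show "card {j. j < n \<and> \<beta> j = \<beta> i \<and> i \<le> j} \<le> card {j\<in>W. \<beta> j = \<beta> i}" by simp
  qed
  ultimately show ?thesis by simp
qed

text \<open>Label each position by its \<beta>-value and its membership, once in \<open>W\<close>
  and once in the sifted set. Both labellings have equal fibre sizes, so a permutation carries one
  to the other: the first component puts it in the stabilizer, the second determines the image of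
  \<open>W\<close>.\<close>

lemma sift_stabilizer:
  assumes W: "W \<subseteq> {..<n}"
  shows "\<exists>\<sigma>\<in>stabilizer n \<beta>. \<sigma> ` W = sift n \<beta> W"
proof -
  let ?S = "sift n \<beta> W"
  have "card {i\<in>{..<n}. (\<beta> i, i \<in> W) = x} = card {i\<in>{..<n}. (\<beta> i, i \<in> ?S) = x}" for x
  proof (cases x)
    case (Pair v b)
    have in_: "card {i\<in>{..<n}. (\<beta> i, i \<in> X) = (v, True)} = card {i\<in>X. \<beta> i = v}"
      if "X \<subseteq> {..<n}" for X using that by (intro arg_cong[where f = card]) auto
    have out: "card {i\<in>{..<n}. (\<beta> i, i \<in> X) = (v, False)} =
        card {i\<in>{..<n}. \<beta> i = v} - card {i\<in>X. \<beta> i = v}" if "X \<subseteq> {..<n}" for X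
    proof -
      have "{i\<in>{..<n}. (\<beta> i, i \<in> X) = (v, False)} = {i\<in>{..<n}. \<beta> i = v} - {i\<in>X. \<beta> i = v}"
        by auto
      thus ?thesis using that by (simp only:) (intro card_Diff_subset; auto intro: finite_subset)
    qed
    show ?thesis
      using card_sift_fibre[OF W, of \<beta> v] in_[OF W] in_[OF sift_subset] out[OF W] out[OF sift_subset]
      unfolding Pair by (cases b) simp_all
  qed
  from permutes_of_fibre_cards[OF _ this] obtain p where
    p: "p permutes {..<n}" "\<And>i. i < n \<Longrightarrow> \<beta> i = \<beta> (p i) \<and> (i \<in> W \<longleftrightarrow> p i \<in> ?S)" by auto
  have "p ` W = ?S"
  proof (intro set_eqI iffI)
    fix y assume y: "y \<in> ?S"
    hence "y \<in> {..<n}" using sift_subset by blast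
    then obtain i where "i < n" "y = p i" using permutes_image[OF p(1)] by (metis imageE lessThan_iff)
    thus "y \<in> p ` W" using p(2) y by auto
  qed (use p(2) W in auto)
  thus ?thesis using p by (auto simp: stabilizer_def)
qed

lemma card_sift:
  assumes "W \<subseteq> {..<n}"
  shows "card (sift n \<beta> W) = card W"
proof -
  obtain \<sigma> where "\<sigma> permutes {..<n}" "\<sigma> ` W = sift n \<beta> W"
    using sift_stabilizer[OF assms, of \<beta>] by (auto simp: stabilizer_def)
  thus ?thesis by (metis card_image inj_on_subset permutes_inj subset_UNIV)
qed

text \<open>Composing \<open>p\<close> with \<sigma> permutes positions within the fibres of
  \<beta>, so it changes neither the weight on the ground set nor the set \<open>p\<close> \<sigma>
  \<open>W\<close> that is tested for optimality.\<close>

lemma card_orderings_stabilizer: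
  assumes M: "matroid_on {..<n} Bs" and \<sigma>: "\<sigma> \<in> stabilizer n \<beta>"
  shows "card (orderings n Bs \<beta> (\<sigma> ` W)) = card (orderings n Bs \<beta> W)"
proof -
  have s: "\<sigma> permutes {..<n}" "\<And>i. i < n \<Longrightarrow> \<beta> (\<sigma> i) = \<beta> i" using \<sigma> by (auto simp: stabilizer_def)
  have key: "p \<in> orderings n Bs \<beta> (\<sigma> ` W) \<longleftrightarrow> p \<circ> \<sigma> \<in> orderings n Bs \<beta> W"
    if p: "p permutes {..<n}" for p
  proof -
    have pm: "p \<circ> \<sigma> permutes {..<n}" by (rule permutes_compose[OF s(1) p])
    have iv: "inv (p \<circ> \<sigma>) = inv \<sigma> \<circ> inv p"
      using p s(1) by (metis o_inv_distrib permutes_bij)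
    have "\<beta> (inv \<sigma> (inv p e)) = \<beta> (inv p e)" if "e < n" for e
    proof -
      have "inv p e < n" using that permutes_in_image[OF permutes_inv[OF p], of e] by simp
      hence "inv \<sigma> (inv p e) < n" using permutes_in_image[OF permutes_inv[OF s(1)], of "inv p e"] by simp
      from s(2)[OF this] show ?thesis using permutes_inverses(1)[OF s(1)] by simp
    qed
    hence "local_opt {..<n} Bs (\<beta> \<circ> inv p) (p ` \<sigma> ` W) \<longleftrightarrow>
        local_opt {..<n} Bs (\<beta> \<circ> inv (p \<circ> \<sigma>)) (p ` \<sigma> ` W)"
      by (intro local_opt_cong[OF M]) (simp add: iv)
    thus ?thesis using p pm by (simp add: orderings_def image_comp)
  qed
  have "bij_betw (\<lambda>p. p \<circ> \<sigma>) (orderings n Bs \<beta> (\<sigma> ` W)) (orderings n Bs \<beta> W)"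
  proof (rule bij_betw_byWitness[where f' = "\<lambda>p. p \<circ> inv \<sigma>"])
    show "\<forall>p\<in>orderings n Bs \<beta> (\<sigma> ` W). p \<circ> \<sigma> \<circ> inv \<sigma> = p"
      "\<forall>p\<in>orderings n Bs \<beta> W. p \<circ> inv \<sigma> \<circ> \<sigma> = p"
      using permutes_inv_o[OF s(1)] by (simp_all add: comp_assoc)
    show "(\<lambda>p. p \<circ> \<sigma>) ` orderings n Bs \<beta> (\<sigma> ` W) \<subseteq> orderings n Bs \<beta> W"
      using key by (auto simp: orderings_def)
    show "(\<lambda>p. p \<circ> inv \<sigma>) ` orderings n Bs \<beta> W \<subseteq> orderings n Bs \<beta> (\<sigma> ` W)"
    proof (intro image_subsetI)
      fix p assume p: "p \<in> orderings n Bs \<beta> W"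
      hence "p permutes {..<n}" by (simp add: orderings_def)
      hence "p \<circ> inv \<sigma> permutes {..<n}" by (rule permutes_compose[OF permutes_inv[OF s(1)]])
      from key[OF this] show "p \<circ> inv \<sigma> \<in> orderings n Bs \<beta> (\<sigma> ` W)"
        using p permutes_inv_o[OF s(1)] by (simp add: comp_assoc)
    qed
  qed
  from bij_betw_same_card[OF this] show ?thesis .
qed

lemma orderings_eq_id:
  assumes M: "matroid_on {..<n} Bs" and mono: "\<And>i j. i \<le> j \<Longrightarrow> j < n \<Longrightarrow> \<beta> i \<le> \<beta> j"
    and up: "\<And>i j. i \<in> W \<Longrightarrow> i < j \<Longrightarrow> j < n \<Longrightarrow> \<beta> j = \<beta> i \<Longrightarrow> j \<in> W"
  shows "orderings n Bs \<beta> W = orderings n Bs id W"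
proof -
  have "local_opt {..<n} Bs (\<beta> \<circ> inv p) (p ` W) \<longleftrightarrow> local_opt {..<n} Bs (id \<circ> inv p) (p ` W)"
    if p: "p permutes {..<n}" for p
  proof -
    \<comment> \<open>Optimality only compares a position i in \<open>W\<close> with a position j
      outside \<open>W\<close>. If i < j, monotonicity gives \<beta> i \<le> \<beta> j, and equality
      would put j into \<open>W\<close> by \<open>up\<close>.\<close>
    have "(\<beta> \<circ> inv p) x < (\<beta> \<circ> inv p) y \<longleftrightarrow> (id \<circ> inv p) x < (id \<circ> inv p) y"
      if x: "x \<in> p ` W" "p ` W \<in> Bs" and y: "y \<in> {..<n} - p ` W" for x y
    proof -
      have "x \<in> {..<n}" using x matroid_on_subset[OF M] by blast
      hence ij: "inv p x < n" "inv p y < n"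
        using y permutes_in_image[OF permutes_inv[OF p]] by auto
      have iW: "inv p x \<in> W" "inv p y \<notin> W"
        using x(1) y permutes_inverses[OF p] by (metis DiffD2 imageE imageI)+
      show ?thesis
        using mono[of "inv p x" "inv p y"] mono[of "inv p y" "inv p x"] up[of "inv p x" "inv p y"] ij iW
        by (cases "inv p x < inv p y") (auto simp: not_less le_less)
    qed
    thus ?thesis unfolding local_opt_def by blast
  qed
  thus ?thesis by (auto simp: orderings_def)
qed

lemma card_orderings_sift:
  assumes M: "matroid_on {..<n} Bs" and mono: "\<And>i j. i \<le> j \<Longrightarrow> j < n \<Longrightarrow> \<beta> i \<le> \<beta> j"
    and W: "W \<subseteq> {..<n}"
  shows "card (orderings n Bs \<beta> W) = card (orderings n Bs id (sift n \<beta> W))"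
proof -
  obtain \<sigma> where \<sigma>: "\<sigma> \<in> stabilizer n \<beta>" "\<sigma> ` W = sift n \<beta> W" using sift_stabilizer[OF W] by blast
  have "orderings n Bs \<beta> (sift n \<beta> W) = orderings n Bs id (sift n \<beta> W)"
    using sift_upward by (intro orderings_eq_id[OF M mono])
  thus ?thesis using card_orderings_stabilizer[OF M \<sigma>(1), of W] \<sigma>(2) by simp
qed

section \<open>Schubert matroids\<close>

text \<open>The bases lie above \<open>W\<close> in the Gale order: the r-th smallest element of
  \<open>B\<close> is at least that of \<open>W\<close>. Thus \<open>W\<close> itself is the least
  base.\<close>

definition schubert :: "nat \<Rightarrow> nat set \<Rightarrow> nat set set" where
  "schubert n W = {B. B \<subseteq> {..<n} \<and> card B = card W \<and> (\<forall>k. card (B \<inter> {..<k}) \<le> card (W \<inter> {..<k}))}"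

text \<open>
  The witness \<open>k\<close> is the largest tight position up to \<open>x\<close>.
\<close>

lemma schubert_exchange:
  assumes B: "B \<in> schubert n W" and x: "x \<in> B"
  shows "\<exists>k\<le>x. card (B \<inter> {..<k}) = card (W \<inter> {..<k}) \<and>
    (\<forall>y<n. y \<notin> B \<longrightarrow> k \<le> y \<longrightarrow> insert y (B - {x}) \<in> schubert n W)"
proof -
  have Bn: "B \<subseteq> {..<n}" "card B = card W" and le: "\<And>k. card (B \<inter> {..<k}) \<le> card (W \<inter> {..<k})"
    using B by (auto simp: schubert_def)
  have fin: "finite B" using Bn finite_subset by blast
  define K where "K = {k. k \<le> x \<and> card (B \<inter> {..<k}) = card (W \<inter> {..<k})}"
  have K: "finite K" "0 \<in> K" by (auto simp: K_def)
  define k where "k = Max K"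
  have kK: "k \<in> K" using K Max_in unfolding k_def by blast
  have max: "l \<le> k" if "l \<in> K" for l using K that unfolding k_def by simp
  have "insert y (B - {x}) \<in> schubert n W" if y: "y < n" "y \<notin> B" "k \<le> y" for y
  proof -
    have "card (insert y (B - {x}) \<inter> {..<l}) \<le> card (W \<inter> {..<l})" for l
    \<comment> \<open>Only initial segments that contain \<open>y\<close> but not \<open>x\<close>
      gain an element. They end beyond the last tight position \<open>k\<close>, so the bound is
      strict there.\<close>
    proof (cases "y < l \<and> l \<le> x")
      case True
      hence "l \<notin> K" using max[of l] y by auto
      hence "card (B \<inter> {..<l}) < card (W \<inter> {..<l})" using le[of l] True by (simp add: K_def)
      moreover have "insert y (B - {x}) \<inter> {..<l} = insert y (B \<inter> {..<l})" using True by auto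
      ultimately show ?thesis using fin y by simp
    next
      case False
      have "card (insert y (B - {x}) \<inter> {..<l}) \<le> card (B \<inter> {..<l})"
      proof (cases "y < l")
        case True
        hence "insert y (B - {x}) \<inter> {..<l} = insert y (B \<inter> {..<l} - {x})" "x \<in> B \<inter> {..<l}"
          using False x by auto
        thus ?thesis using fin y card_Suc_Diff1[of "B \<inter> {..<l}" x] by simp
      next
        case False
        thus ?thesis using fin by (intro card_mono) auto
      qed
      thus ?thesis using le[of l] by simp
    qed
    moreover have "card (insert y (B - {x})) = card W"
      using fin x y Bn(2) card_Suc_Diff1[OF fin x] by simp
    ultimately show ?thesis using Bn y by (auto simp: schubert_def)
  qed
  thus ?thesis using kK unfolding K_def by blast
qed

text \<open>Since \<open>k\<close> is tight for \<open>B1\<close>, the base \<open>B2\<close> has at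
  least as many elements from \<open>k\<close> on as \<open>B1\<close>. It lacks \<open>x\<close>
  there, so it has an element outside \<open>B1\<close> there, and every such element is admissible
  for the exchange.\<close>

lemma matroid_on_schubert:
  assumes "W \<subseteq> {..<n}"
  shows "matroid_on {..<n} (schubert n W)"
  unfolding matroid_on_def
proof (intro conjI ballI)
  show "schubert n W \<noteq> {}" using assms by (auto simp: schubert_def)
  fix B1 B2 x assume B: "B1 \<in> schubert n W" "B2 \<in> schubert n W" "x \<in> B1 - B2"
  obtain k where k: "k \<le> x" "card (B1 \<inter> {..<k}) = card (W \<inter> {..<k})"
    "\<And>y. y < n \<Longrightarrow> y \<notin> B1 \<Longrightarrow> k \<le> y \<Longrightarrow> insert y (B1 - {x}) \<in> schubert n W"
    using schubert_exchange[of B1 n W x] B by auto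
  have sub: "B1 \<subseteq> {..<n}" "B2 \<subseteq> {..<n}" and cd: "card B1 = card W" "card B2 = card W"
    and le: "card (B2 \<inter> {..<k}) \<le> card (W \<inter> {..<k})" using B by (auto simp: schubert_def)
  have fin: "finite B1" "finite B2" using sub finite_subset by blast+
  show "\<exists>y\<in>B2 - B1. insert y (B1 - {x}) \<in> schubert n W"
  proof (rule ccontr)
    assume no: "\<not> ?thesis"
    have "y \<in> B1 - {..<k}" if "y \<in> B2 - {..<k}" for y
      using no k(3)[of y] that sub by auto
    hence "B2 - {..<k} \<subset> B1 - {..<k}" using B(3) k(1) by auto
    hence "card (B2 - {..<k}) < card (B1 - {..<k})" using fin by (intro psubset_card_mono) auto
    have "card C = card (C \<inter> {..<k}) + card (C - {..<k})" if "finite C" for C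
      using that by (metis card_Diff_subset_Int card_mono finite_Int inf_le1 le_add_diff_inverse)
    from this[OF fin(1)] this[OF fin(2)] \<open>card (B2 - {..<k}) < _\<close>
    show False using le k(2) cd by linarith
  qed
qed (auto simp: schubert_def)

text \<open>The natural order is a witness: replacing an element of \<open>W\<close> by a smaller
  \<open>y\<close> would overfill the initial segment ending in \<open>y\<close>.\<close>

lemma orderings_schubert_self:
  assumes W: "W \<subseteq> {..<n}"
  shows "orderings n (schubert n W) id W \<noteq> {}"
proof -
  have fin: "finite W" using W finite_subset by blast
  have "x < y" if "x \<in> W" "y \<in> {..<n} - W" "insert y (W - {x}) \<in> schubert n W" for x y
  proof (rule ccontr)
    assume "\<not> x < y"
    hence "insert y (W - {x}) \<inter> {..<Suc y} = insert y (W \<inter> {..<Suc y})" using that by auto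
    hence "card (insert y (W - {x}) \<inter> {..<Suc y}) = Suc (card (W \<inter> {..<Suc y}))"
      using that fin by simp
    moreover have "card (insert y (W - {x}) \<inter> {..<Suc y}) \<le> card (W \<inter> {..<Suc y})"
      using that(3) unfolding schubert_def by blast
    ultimately show False by simp
  qed
  hence "id \<in> orderings n (schubert n W) id W"
    using W by (auto simp: orderings_def local_opt_def permutes_id schubert_def)
  thus ?thesis by blast
qed

text \<open>Let \<open>?X\<close> be the first \<open>i\<close> elements of the order and
  \<open>B\<close> its greedy base. For a suitable tight \<open>k\<close>, the set
  \<open>B \<inter> ?X\<close> contains all of \<open>B\<close> below \<open>k\<close> and all of
  \<open>?X\<close> from \<open>k\<close> on. So it has at least
  \<open>card (W \<inter> {..<k}) + (i - k)\<close> elements, which bounds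
  \<open>card (W \<inter> {..<i})\<close>.\<close>

lemma orderings_schubert_dominates:
  assumes W: "W \<subseteq> {..<n}" and V: "V \<subseteq> {..<n}" and ne: "orderings n (schubert n W) id V \<noteq> {}"
  shows "card (W \<inter> {..<i}) \<le> card (V \<inter> {..<i})"
proof -
  from ne obtain p where p: "p permutes {..<n}" and "local_opt {..<n} (schubert n W) (inv p) (p ` V)"
    by (auto simp: orderings_def)
  define B where "B = p ` V"
  have B: "B \<in> schubert n W" and
    loc: "\<And>x y. x \<in> B \<Longrightarrow> y \<in> {..<n} - B \<Longrightarrow> insert y (B - {x}) \<in> schubert n W \<Longrightarrow> inv p x < inv p y"
    using \<open>local_opt _ _ _ _\<close> unfolding local_opt_def B_def by blast+
  have injp: "inj p" by (rule permutes_inj[OF p])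
  have cd: "card B = card W" "B \<subseteq> {..<n}" and fin: "finite B" "finite W" "finite V"
    using B W V finite_subset unfolding schubert_def by blast+
  have cV: "card V = card B" unfolding B_def using injp by (simp add: card_image inj_on_def)
  have main: "card (W \<inter> {..<i}) \<le> card (V \<inter> {..<i})" if i: "i \<le> n" for i
  proof (cases "B \<subseteq> p ` {..<i}")
    case True
    hence "V \<subseteq> {..<i}" unfolding B_def using injp by (simp add: inj_image_subset_iff)
    hence "V \<inter> {..<i} = V" by blast
    moreover have "card (W \<inter> {..<i}) \<le> card W" using fin by (intro card_mono) auto
    ultimately show ?thesis using cV cd by simp
  next
    case False
    let ?X = "p ` {..<i}"
    have Xn: "?X \<subseteq> {..<n}" using permutes_image[OF p] i by (metis image_mono lessThan_subset_iff)
    \<comment> \<open>Least in the natural order, not in the order \<open>p\<close>: base elements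
      below \<open>k \<le> x\<close> are then forced into \<open>?X\<close>.\<close>
    define x where "x = Min (B - ?X)"
    have x: "x \<in> B - ?X" "\<And>y. y \<in> B - ?X \<Longrightarrow> x \<le> y"
      using False fin Min_in[of "B - ?X"] unfolding x_def by auto
    obtain k where k: "k \<le> x" "card (B \<inter> {..<k}) = card (W \<inter> {..<k})"
      "\<And>y. y < n \<Longrightarrow> y \<notin> B \<Longrightarrow> k \<le> y \<Longrightarrow> insert y (B - {x}) \<in> schubert n W"
      using schubert_exchange[OF B, of x] x by auto
    have "y \<in> B" if y: "y \<in> ?X - {..<k}" for y
    proof (rule ccontr)
      assume "y \<notin> B"
      moreover have "y < n" "k \<le> y" using y Xn by auto
      ultimately have "inv p x < inv p y" using loc[of x y] x k(3)[of y] by blast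
      moreover have "inv p y < i" using y injp by auto
      moreover have "\<not> inv p x < i" using x(1) permutes_inverses(1)[OF p, of x]
        by (metis DiffD2 imageI lessThan_iff)
      ultimately show False by simp
    qed
    moreover have "B \<inter> {..<k} \<subseteq> ?X" using x(2) k(1) by force
    ultimately have "(B \<inter> {..<k}) \<union> (?X - {..<k}) \<subseteq> B \<inter> ?X" by blast
    hence "card ((B \<inter> {..<k}) \<union> (?X - {..<k})) \<le> card (B \<inter> ?X)" using fin by (intro card_mono) auto
    moreover have "card ((B \<inter> {..<k}) \<union> (?X - {..<k})) = card (W \<inter> {..<k}) + card (?X - {..<k})"
      unfolding k(2)[symmetric] using fin by (intro card_Un_disjoint) auto
    moreover have "card (?X - {..<k}) \<ge> i - k"
    proof -
      have "card ?X = i" using injp by (simp add: card_image inj_on_def)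
      thus ?thesis using diff_card_le_card_Diff[of "{..<k}" ?X] by simp
    qed
    moreover have "card (W \<inter> {..<i}) \<le> card (W \<inter> {..<k}) + (i - k)"
    proof -
      have "card (W \<inter> {..<i}) \<le> card ((W \<inter> {..<k}) \<union> {k..<i})" using fin by (intro card_mono) auto
      also have "\<dots> \<le> card (W \<inter> {..<k}) + (i - k)" using card_Un_le[of "W \<inter> {..<k}" "{k..<i}"] by simp
      finally show ?thesis .
    qed
    moreover have "card (B \<inter> ?X) = card (V \<inter> {..<i})"
      unfolding B_def image_Int[OF injp, symmetric] using injp by (simp add: card_image inj_on_def)
    ultimately show ?thesis by linarith
  qed
  show ?thesis
  proof (cases "i \<le> n")
    case False
    hence "W \<inter> {..<i} = W \<inter> {..<n}" "V \<inter> {..<i} = V \<inter> {..<n}" using W V by auto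
    thus ?thesis using main[of n] by simp
  qed (rule main)
qed

section \<open>Monomials and their order patterns\<close>

text \<open>
  The weakly increasing word on positions \<open>0, 1, \<dots>\<close> that contains the letter \<open>k + 1\<close> exactly
  \<open>lookup a k\<close> times.  Positions \<open>\<ge> mdegree a\<close> carry junk.
\<close>

definition level :: "(nat \<Rightarrow>\<^sub>0 nat) \<Rightarrow> nat \<Rightarrow> nat" where
  "level a i = Suc (LEAST k. i < (\<Sum>j\<le>k. Poly_Mapping.lookup a j))"

lemma sum_lookup_le_mdegree:
  "(\<Sum>j\<le>k. Poly_Mapping.lookup a j) \<le> mdegree a"
proof -
  have "(\<Sum>j\<le>k. Poly_Mapping.lookup a j) = (\<Sum>j\<in>{..k} \<inter> Poly_Mapping.keys a. Poly_Mapping.lookup a j)"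
    by (rule sum.mono_neutral_right) (auto simp: in_keys_iff)
  also have "\<dots> \<le> mdegree a" unfolding mdegree_def by (rule sum_mono2) auto
  finally show ?thesis .
qed

lemma ex_sum_lookup_gt:
  assumes "i < mdegree a"
  shows "\<exists>k. i < (\<Sum>j\<le>k. Poly_Mapping.lookup a j)"
proof -
  have "mdegree a \<le> (\<Sum>j\<le>Max (Poly_Mapping.keys a). Poly_Mapping.lookup a j)"
    unfolding mdegree_def by (rule sum_mono2) auto
  with assms show ?thesis by (meson less_le_trans)
qed

lemma level_eq_Suc_iff:
  assumes i: "i < mdegree a"
  shows "level a i = Suc k \<longleftrightarrow>
    (\<Sum>j<k. Poly_Mapping.lookup a j) \<le> i \<and> i < (\<Sum>j\<le>k. Poly_Mapping.lookup a j)"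
    (is "_ \<longleftrightarrow> ?r k")
proof -
  let ?P = "\<lambda>k. i < (\<Sum>j\<le>k. Poly_Mapping.lookup a j)"
  have r: "?r k" if "level a i = Suc k" for k
  proof -
    have k: "k = (LEAST k. ?P k)" using that by (simp add: level_def)
    have "?P k" unfolding k by (rule LeastI_ex[OF ex_sum_lookup_gt[OF i]])
    moreover have "(\<Sum>j<k. Poly_Mapping.lookup a j) \<le> i"
    proof (cases k)
      case (Suc l)
      hence "\<not> ?P l" using not_less_Least[of l ?P] k by simp
      thus ?thesis using Suc by (simp add: lessThan_Suc_atMost)
    qed simp
    ultimately show ?thesis by simp
  qed
  have "k = l" if kl: "?r k" "?r l" for k l
  proof -
    have no: False if "u < v" "?r u" "?r v" for u v
    proof -
      have "(\<Sum>j\<le>u. Poly_Mapping.lookup a j) \<le> (\<Sum>j<v. Poly_Mapping.lookup a j)"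
        using that(1) by (intro sum_mono2) auto
      thus False using that by linarith
    qed
    show ?thesis using no[of k l] no[of l k] kl by (meson linorder_less_linear)
  qed
  thus ?thesis using r by (metis level_def)
qed

lemma card_level_fibre:
  "card {i. i < mdegree a \<and> level a i = Suc k} = Poly_Mapping.lookup a k"
proof -
  have "{i. i < mdegree a \<and> level a i = Suc k} =
      {(\<Sum>j<k. Poly_Mapping.lookup a j)..<(\<Sum>j\<le>k. Poly_Mapping.lookup a j)}"
    using level_eq_Suc_iff sum_lookup_le_mdegree[of a k] by fastforce
  thus ?thesis by (simp add: lessThan_Suc_atMost[symmetric])
qed

lemma level_pos: "level a \<in> A \<rightarrow> {1..}"
  by (simp add: level_def)

lemma level_mono:
  assumes "i \<le> j" "j < mdegree a"
  shows "level a i \<le> level a j"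
proof -
  let ?P = "\<lambda>i k. i < (\<Sum>j\<le>k. Poly_Mapping.lookup a j)"
  have "?P j (LEAST k. ?P j k)" by (rule LeastI_ex[OF ex_sum_lookup_gt[OF assms(2)]])
  hence "?P i (LEAST k. ?P j k)" using assms(1) by linarith
  hence "(LEAST k. ?P i k) \<le> (LEAST k. ?P j k)" by (rule Least_le)
  thus ?thesis by (simp add: level_def)
qed

lemma monom_of_level: "monom_of {..<mdegree a} (level a) = a"
proof (rule poly_mapping_eqI)
  fix k
  show "Poly_Mapping.lookup (monom_of {..<mdegree a} (level a)) k = Poly_Mapping.lookup a k"
    using lookup_monom_of[OF _ level_pos, of "{..<mdegree a}" a k] card_level_fibre[of a k] by simp
qed

section \<open>End sets and order patterns of words\<close>

text \<open>
  For a weakly increasing word this set encodes the composition of \<open>n\<close> given by its fibre sizes.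
\<close>

definition ends :: "nat \<Rightarrow> (nat \<Rightarrow> nat) \<Rightarrow> nat set" where
  "ends n \<beta> = {i. i < n \<and> (\<forall>j. i < j \<and> j < n \<longrightarrow> \<beta> i < \<beta> j)}"

lemma ex_end:
  assumes mono: "\<And>i j. i \<le> j \<Longrightarrow> j < n \<Longrightarrow> \<beta> i \<le> (\<beta> j :: nat)" and i: "i < n"
  shows "\<exists>e\<in>ends n \<beta>. i \<le> e \<and> \<beta> e = \<beta> i"
proof -
  let ?I = "{j. j < n \<and> \<beta> j = \<beta> i}"
  have fin: "finite ?I" "i \<in> ?I" using i by auto
  define e where "e = Max ?I"
  have e: "e \<in> ?I" "\<And>j. j \<in> ?I \<Longrightarrow> j \<le> e"
    unfolding e_def using Max_in[OF fin(1)] Max_ge[OF fin(1)] fin(2) by blast+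
  have "\<beta> e < \<beta> j" if "e < j" "j < n" for j
    using mono[of e j] that e by (metis (mono_tags, lifting) leD le_neq_implies_less less_imp_le mem_Collect_eq)
  hence "e \<in> ends n \<beta>" using e by (auto simp: ends_def)
  thus ?thesis using e fin by blast
qed

text \<open>A weakly increasing word rises exactly when it passes an end, so its set of ends fixes
  its whole order pattern.\<close>

lemma less_iff_ends:
  assumes mono: "\<And>i j. i \<le> j \<Longrightarrow> j < n \<Longrightarrow> \<beta> i \<le> (\<beta> j :: nat)" and ij: "i < n" "j < n"
  shows "\<beta> i < \<beta> j \<longleftrightarrow> (\<exists>e\<in>ends n \<beta>. i \<le> e \<and> e < j)"
proof
  assume l: "\<beta> i < \<beta> j"
  obtain e where e: "e \<in> ends n \<beta>" "i \<le> e" "\<beta> e = \<beta> i" using ex_end[of n \<beta> i, OF mono ij(1)] by blast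
  have "e < n" using e by (simp add: ends_def)
  hence "e < j" using mono[of j e] l e(3) by (metis leD not_less)
  thus "\<exists>e\<in>ends n \<beta>. i \<le> e \<and> e < j" using e by blast
next
  assume "\<exists>e\<in>ends n \<beta>. i \<le> e \<and> e < j"
  then obtain e where e: "e \<in> ends n \<beta>" "i \<le> e" "e < j" by blast
  hence "\<beta> i \<le> \<beta> e" "\<beta> e < \<beta> j" using mono[of i e] ij by (auto simp: ends_def)
  thus "\<beta> i < \<beta> j" by simp
qed

text \<open>Words with the same ends have the same fibres in the same order. Matching the letters
  fibre by fibre gives an increasing map \<theta> of variables that preserves exponents, so both
  monomials carry the same composition \<open>cs\<close>.\<close>

lemma quasisymmetric_ends:
  assumes h: "quasisymmetric h" and n: "mdegree a = n" "mdegree b = n"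
    and ends: "ends n (level a) = ends n (level b)"
  shows "h a = h b"
proof -
  have pat: "level a i < level a j \<longleftrightarrow> level b i < level b j" if "i < n" "j < n" for i j
    using less_iff_ends[of n "level a" i j] less_iff_ends[of n "level b" i j] level_mono n that ends
    by simp
  hence pat_eq: "level a i = level a j \<longleftrightarrow> level b i = level b j" if "i < n" "j < n" for i j
    using that by (metis nat_neq_iff)
  define K where "K = Poly_Mapping.keys a"
  \<comment> \<open>Some position carrying the letter \<open>k + 1\<close> of \<open>a\<close>. The
    letter of \<open>b\<close> at that position names the variable \<theta> k, after undoing the
    shift by one between letters and variable indices.\<close>
  define r where "r k = (SOME i. i < n \<and> level a i = Suc k)" for k
  have r: "r k < n" "level a (r k) = Suc k" if "k \<in> K" for k
  proof -
    have "card {i. i < n \<and> level a i = Suc k} \<noteq> 0"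
      using that card_level_fibre[of a k] n by (simp add: K_def in_keys_iff)
    hence "\<exists>i. i < n \<and> level a i = Suc k" by (metis (mono_tags, lifting) card.empty empty_Collect_eq)
    from someI_ex[OF this] show "r k < n" "level a (r k) = Suc k" unfolding r_def by auto
  qed
  define \<theta> where "\<theta> k = level b (r k) - 1" for k
  have \<theta>: "Suc (\<theta> k) = level b (r k)" for k by (simp add: \<theta>_def level_def)
  have \<theta>_less: "\<theta> k < \<theta> l" if "k \<in> K" "l \<in> K" "k < l" for k l
    using pat[OF r(1) r(1), OF that(1,2)] r(2)[OF that(1)] r(2)[OF that(2)] that(3) \<theta>[of k] \<theta>[of l]
    by simp
  have \<theta>_lookup: "Poly_Mapping.lookup b (\<theta> k) = Poly_Mapping.lookup a k" if "k \<in> K" for k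
  proof -
    have "{i. i < n \<and> level b i = Suc (\<theta> k)} = {i. i < n \<and> level a i = Suc k}"
      unfolding \<theta> using pat_eq[OF _ r(1)[OF that]] r(2)[OF that] by auto
    thus ?thesis using card_level_fibre[of a k] card_level_fibre[of b "\<theta> k"] n by simp
  qed
  have \<theta>_notin: "Poly_Mapping.lookup b l = 0" if "l \<notin> \<theta> ` K" for l
  proof (rule ccontr)
    assume "Poly_Mapping.lookup b l \<noteq> 0"
    hence "card {i. i < n \<and> level b i = Suc l} \<noteq> 0" using card_level_fibre[of b l] n by simp
    then obtain i where i: "i < n" "level b i = Suc l"
      by (metis (mono_tags, lifting) card.empty empty_Collect_eq)
    obtain k where k: "level a i = Suc k" by (simp add: level_def)
    have "i \<in> {i. i < n \<and> level a i = Suc k}" using i k by simp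
    hence "card {i. i < n \<and> level a i = Suc k} \<noteq> 0" by (subst card_0_eq) auto
    hence "Poly_Mapping.lookup a k \<noteq> 0" using card_level_fibre[of a k, unfolded n] by argo
    hence kK: "k \<in> K" by (simp add: K_def in_keys_iff)
    have "level b (r k) = level b i" using pat_eq[OF r(1)[OF kK] i(1)] r(2)[OF kK] k by simp
    hence "\<theta> k = l" using \<theta>[of k] i by simp
    thus False using that kK by blast
  qed
  define ks where "ks = sorted_list_of_set K"
  have ks: "set ks = K" "sorted_wrt (<) ks" by (auto simp: ks_def K_def)
  define cs where "cs = map (Poly_Mapping.lookup a) ks"
  have sorted: "sorted_wrt (<) (map \<theta> ks)"
    using ks \<theta>_less unfolding sorted_wrt_map by (auto intro: sorted_wrt_mono_rel[of ks "(<)"])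
  have len: "length ks = length cs" "length (map \<theta> ks) = length cs" by (simp_all add: cs_def)
  have "list_monom ks cs = a"
  proof (rule poly_mapping_eqI)
    fix k
    show "Poly_Mapping.lookup (list_monom ks cs) k = Poly_Mapping.lookup a k"
    proof (cases "k \<in> set ks")
      case True
      then obtain t where "t < length cs" "k = ks ! t" using len(1) by (metis in_set_conv_nth)
      thus ?thesis using lookup_list_monom_nth[OF ks(2) len(1)] by (simp add: cs_def)
    next
      case False
      hence "Poly_Mapping.lookup a k = 0" using ks by (simp add: K_def in_keys_iff)
      thus ?thesis using lookup_list_monom_notin[OF len(1) False] by simp
    qed
  qed
  moreover have "list_monom (map \<theta> ks) cs = b"
  proof (rule poly_mapping_eqI)
    fix k
    show "Poly_Mapping.lookup (list_monom (map \<theta> ks) cs) k = Poly_Mapping.lookup b k"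
    proof (cases "k \<in> set (map \<theta> ks)")
      case True
      then obtain t where t: "t < length cs" "k = map \<theta> ks ! t" using len(2) by (metis in_set_conv_nth)
      hence "ks ! t \<in> K" using ks(1) len(1) by (metis nth_mem)
      hence "cs ! t = Poly_Mapping.lookup b (\<theta> (ks ! t))" using t(1) \<theta>_lookup by (simp add: cs_def)
      moreover have "k = \<theta> (ks ! t)" using t len(1) by simp
      ultimately show ?thesis using lookup_list_monom_nth[OF sorted len(2) t(1)] t(2) by simp
    next
      case False
      hence "Poly_Mapping.lookup b k = 0" using ks \<theta>_notin by simp
      thus ?thesis using lookup_list_monom_notin[OF len(2) False] by simp
    qed
  qed
  moreover have "\<forall>c\<in>set cs. 0 < c" using ks(1) by (auto simp: cs_def K_def in_keys_iff)
  ultimately show ?thesis using h ks(2) sorted len unfolding quasisymmetric_def by metis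
qed

section \<open>Functions spanned by matroid series over the rationals\<close>

text \<open>The rational span of the image of \<open>mat_qsym\<close>, expressed by clearing
  denominators, so that \<open>m\<close> stays an integral combination of matroids.\<close>

definition rational_image :: "((nat \<Rightarrow>\<^sub>0 nat) \<Rightarrow> rat) set" where
  "rational_image = {h. \<exists>N::nat. N > 0 \<and> (\<exists>m. \<forall>a. of_nat N * h a = of_int (qcoeff (mat_qsym m) a))}"

lemma qcoeff_mat_qsym_cmul: "qcoeff (mat_qsym (frag_cmul z m)) a = z * qcoeff (mat_qsym m) a"
proof (cases "z = 0")
  case False
  hence "Poly_Mapping.keys (frag_cmul z m) = Poly_Mapping.keys m" by (auto simp: in_keys_iff)
  thus ?thesis by (simp add: mat_qsym.rep_eq sum_distrib_left mult.assoc)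
qed (simp add: mat_qsym.rep_eq)

lemma rational_image_0: "(\<lambda>_. 0) \<in> rational_image"
  unfolding rational_image_def
  by (intro CollectI exI[of _ 1] conjI exI[of _ 0]) (simp_all add: mat_qsym.rep_eq)

lemma rational_image_cmult:
  assumes "h \<in> rational_image"
  shows "(\<lambda>a. c * h a) \<in> rational_image"
proof -
  obtain N m where N: "N > 0" and m: "\<And>a. of_nat N * h a = of_int (qcoeff (mat_qsym m) a)"
    using assms by (auto simp: rational_image_def)
  obtain p q where pq: "quotient_of c = (p, q)" by fastforce
  have q: "q > 0" by (rule quotient_of_denom_pos[OF pq])
  have c: "c = of_int p / of_int q" by (rule quotient_of_div[OF pq])
  have "of_nat (N * nat q) * (c * h a) = of_int (qcoeff (mat_qsym (frag_cmul p m)) a)" for a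
  proof -
    have "of_nat (N * nat q) * (c * h a) = of_int p * (of_nat N * h a)"
      using q by (simp add: c of_nat_nat)
    thus ?thesis by (simp add: m qcoeff_mat_qsym_cmul)
  qed
  moreover have "N * nat q > 0" using N q by simp
  ultimately show ?thesis unfolding rational_image_def by blast
qed

lemma rational_image_add:
  assumes "g \<in> rational_image" "h \<in> rational_image"
  shows "(\<lambda>a. g a + h a) \<in> rational_image"
proof -
  obtain N m where N: "N > 0" "\<And>a. of_nat N * g a = of_int (qcoeff (mat_qsym m) a)"
    using assms(1) by (auto simp: rational_image_def)
  obtain L l where L: "L > 0" "\<And>a. of_nat L * h a = of_int (qcoeff (mat_qsym l) a)"
    using assms(2) by (auto simp: rational_image_def)
  have "of_nat (N * L) * (g a + h a) =
      of_int (qcoeff (mat_qsym (frag_cmul (int L) m + frag_cmul (int N) l)) a)" for a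
    by (simp add: mat_qsym_add plus_qsym.rep_eq qcoeff_mat_qsym_cmul N(2)[symmetric] L(2)[symmetric]
        algebra_simps)
  moreover have "N * L > 0" using N L by simp
  ultimately show ?thesis unfolding rational_image_def by blast
qed

lemma rational_image_sum:
  assumes "\<And>i. i \<in> I \<Longrightarrow> h i \<in> rational_image"
  shows "(\<lambda>a. \<Sum>i\<in>I. h i a) \<in> rational_image"
  using assms
  by (induction I rule: infinite_finite_induct) (auto intro: rational_image_0 rational_image_add)

lemma rational_image_diff:
  assumes "g \<in> rational_image" "h \<in> rational_image"
  shows "(\<lambda>a. g a - h a) \<in> rational_image"
  using rational_image_add[OF assms(1) rational_image_cmult[OF assms(2), of "-1"]] by simp

lemma matroid_series_rational_image:
  assumes "matroid_on E Bs"
  shows "(\<lambda>a. of_int (matroid_series (E :: nat set) Bs a)) \<in> rational_image"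
proof -
  let ?c = "abs_matroid_class (Abs_matroid (E, Bs))"
  have "qcoeff (mat_qsym (frag_of ?c)) = matroid_series E Bs"
    unfolding mat_qsym_frag_of class_qsym.abs_eq using assms
    by (simp add: matroid_qsym.rep_eq Abs_matroid_inverse)
  thus ?thesis unfolding rational_image_def
    by (intro CollectI exI[of _ 1] conjI exI[of _ "frag_of ?c"]) simp_all
qed

lemma rational_image_ends:
  assumes h: "h \<in> rational_image" and "mdegree a = n" "mdegree b = n"
    and "ends n (level a) = ends n (level b)"
  shows "h a = h b"
proof -
  obtain N m where N: "N > 0" "\<And>a. of_nat N * h a = of_int (qcoeff (mat_qsym m) a)"
    using h by (auto simp: rational_image_def)
  have "quasisymmetric (qcoeff (mat_qsym m))" using qcoeff by blast
  from quasisymmetric_ends[OF this assms(2-)] have "of_nat N * h a = of_nat N * h b"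
    by (simp add: N(2))
  thus ?thesis using N(1) by simp
qed

text \<open>
  The contribution of one order with base positions \<open>W\<close> to the series of any matroid
  (see \<open>matroid_series_word_fn\<close>).
\<close>

definition word_fn :: "nat \<Rightarrow> nat set \<Rightarrow> (nat \<Rightarrow>\<^sub>0 nat) \<Rightarrow> rat" where
  "word_fn n W a = (if mdegree a = n
     then of_nat (card {V\<in>Pow {..<n}. sift n (level a) V = W}) / of_nat (card (stabilizer n (level a)))
     else 0)"

text \<open>Apply the double count to the word \<open>level a\<close>, replace each position set by
  its sift, group by the sifted set and divide by the order of the stabilizer. In other degrees both
  sides vanish.\<close>

lemma matroid_series_word_fn:
  assumes M: "matroid_on {..<n} Bs"
  shows "of_int (matroid_series {..<n} Bs a) =
    (\<Sum>V\<in>Pow {..<n}. of_nat (card (orderings n Bs id V)) * word_fn n V a)"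
proof (cases "mdegree a = n")
  case True
  let ?\<beta> = "level a" and ?g = "\<lambda>V. card (orderings n Bs id V)"
  let ?s = "of_nat (card (stabilizer n ?\<beta>)) :: rat"
  have s: "?s \<noteq> 0" using card_stabilizer_pos[of n ?\<beta>] by simp
  have "(\<Sum>W\<in>Pow {..<n}. card (orderings n Bs ?\<beta> W)) = (\<Sum>W\<in>Pow {..<n}. ?g (sift n ?\<beta> W))"
    using level_mono[of _ _ a] True by (intro sum.cong refl card_orderings_sift[OF M]) auto
  also have "\<dots> = (\<Sum>V\<in>Pow {..<n}. \<Sum>W\<in>{W\<in>Pow {..<n}. sift n ?\<beta> W = V}. ?g (sift n ?\<beta> W))"
    using sift_subset by (intro sum.group[symmetric]) auto
  also have "\<dots> = (\<Sum>V\<in>Pow {..<n}. card {W\<in>Pow {..<n}. sift n ?\<beta> W = V} * ?g V)"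
    by (intro sum.cong) auto
  finally have "int (card (stabilizer n ?\<beta>)) * matroid_series {..<n} Bs a =
      int (\<Sum>V\<in>Pow {..<n}. card {W\<in>Pow {..<n}. sift n ?\<beta> W = V} * ?g V)"
    using matroid_series_orderings[OF M level_pos, of a] monom_of_level[of a] True by simp
  hence "of_int (int (card (stabilizer n ?\<beta>)) * matroid_series {..<n} Bs a) =
      (of_int (int (\<Sum>V\<in>Pow {..<n}. card {W\<in>Pow {..<n}. sift n ?\<beta> W = V} * ?g V)) :: rat)"
    by (rule arg_cong)
  hence "?s * of_int (matroid_series {..<n} Bs a) =
      (\<Sum>V\<in>Pow {..<n}. of_nat (card {W\<in>Pow {..<n}. sift n ?\<beta> W = V}) * of_nat (?g V))"
    by simp
  also have "\<dots> = ?s * (\<Sum>V\<in>Pow {..<n}. of_nat (?g V) * word_fn n V a)"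
    unfolding sum_distrib_left using s True by (intro sum.cong) (simp_all add: word_fn_def)
  finally show ?thesis using s by simp
next
  case False
  have no: "monom_of {..<n} f \<noteq> a" if "f \<in> {..<n} \<rightarrow>\<^sub>E {1..}" for f
  proof -
    have "f \<in> {..<n} \<rightarrow> {1..}" using that by (auto simp: PiE_def)
    from mdegree_monom_of[OF _ this] show ?thesis using False by auto
  qed
  hence "{f \<in> {..<n} \<rightarrow>\<^sub>E {1..}. generic Bs f \<and> monom_of {..<n} f = a} = {}" by blast
  hence "matroid_series {..<n} Bs a = 0" unfolding matroid_series_def by (simp only: card.empty)
  thus ?thesis using False by (simp add: word_fn_def)
qed

section \<open>Inverting the triangular system of Schubert matroids\<close>

lemma eq_if_card_initial_eq:
  fixes V W :: "nat set"
  assumes "V \<subseteq> {..<n}" "W \<subseteq> {..<n}"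
    and eq: "\<And>i. i \<le> n \<Longrightarrow> card (V \<inter> {..<i}) = card (W \<inter> {..<i})"
  shows "V = W"
proof -
  have step: "x \<in> X \<longleftrightarrow> card (X \<inter> {..<Suc x}) \<noteq> card (X \<inter> {..<x})" for x and X :: "nat set"
  proof (cases "x \<in> X")
    case True
    hence "X \<inter> {..<Suc x} = insert x (X \<inter> {..<x})" by auto
    thus ?thesis using True by simp
  next
    case False
    hence "X \<inter> {..<Suc x} = X \<inter> {..<x}" by (auto simp: less_Suc_eq)
    thus ?thesis using False by simp
  qed
  have "x \<in> V \<longleftrightarrow> x \<in> W" if "x < n" for x
    using step[of x V] step[of x W] eq[of x] eq[of "Suc x"] that by simp
  thus ?thesis using assms(1,2) by blast
qed

text \<open>The series of the Schubert matroid of \<open>W\<close> involves only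
  \<open>word_fn n V\<close> with \<open>V\<close> dominating \<open>W\<close>, with non-zero
  coefficient at \<open>W\<close> itself, so it can be solved for \<open>word_fn n W\<close>. The
  measure drops as soon as one initial segment of \<open>V\<close> is strictly fuller.\<close>

lemma word_fn_rational_image:
  "W \<subseteq> {..<n} \<Longrightarrow> word_fn n W \<in> rational_image"
proof (induction "\<Sum>i\<le>n. n - card (W \<inter> {..<i})" arbitrary: W rule: less_induct)
  case less
  let ?Bs = "schubert n W"
  let ?g = "\<lambda>V. of_nat (card (orderings n ?Bs id V)) :: rat"
  have M: "matroid_on {..<n} ?Bs" by (rule matroid_on_schubert[OF less.prems])
  have gW: "?g W \<noteq> 0" using orderings_schubert_self[OF less.prems] finite_orderings by simp
  have rest: "(\<lambda>a. ?g V * word_fn n V a) \<in> rational_image" if V: "V \<in> Pow {..<n} - {W}" for V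
  proof (cases "orderings n ?Bs id V = {}")
    case False
    have le: "card (W \<inter> {..<i}) \<le> card (V \<inter> {..<i})" for i
      using orderings_schubert_dominates[OF less.prems _ False] V by blast
    obtain i where i: "i \<le> n" "card (W \<inter> {..<i}) \<noteq> card (V \<inter> {..<i})"
      using eq_if_card_initial_eq[of V n W] V less.prems by (metis Diff_iff Pow_iff singletonI)
    have "card (V \<inter> {..<i}) \<le> card {..<n}" using V by (intro card_mono) auto
    hence "n - card (V \<inter> {..<i}) < n - card (W \<inter> {..<i})"
      using le[of i] i(2) unfolding card_lessThan by linarith
    hence "(\<Sum>i\<le>n. n - card (V \<inter> {..<i})) < (\<Sum>i\<le>n. n - card (W \<inter> {..<i}))"
      using le i(1) by (intro sum_strict_mono_ex1 ballI bexI[of _ i] diff_le_mono2) auto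
    from less.hyps[OF this] show ?thesis using V by (intro rational_image_cmult) auto
  qed (simp add: rational_image_0)
  have "(\<lambda>a. inverse (?g W) * (of_int (matroid_series {..<n} ?Bs a) -
      (\<Sum>V\<in>Pow {..<n} - {W}. ?g V * word_fn n V a))) \<in> rational_image"
    by (intro rational_image_cmult rational_image_diff rational_image_sum
        matroid_series_rational_image[OF M] rest)
  moreover have "inverse (?g W) * (of_int (matroid_series {..<n} ?Bs a) -
      (\<Sum>V\<in>Pow {..<n} - {W}. ?g V * word_fn n V a)) = word_fn n W a" for a
    using less.prems gW unfolding matroid_series_word_fn[OF M] by (subst sum.remove[of _ W]) auto
  ultimately show ?case by simp
qed

section \<open>Sign-reversing involutions and alternating sums\<close>

definition toggle :: "'a \<Rightarrow> 'a set \<Rightarrow> 'a set" where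
  "toggle e V = (if e \<in> V then V - {e} else insert e V)"

lemma toggle_toggle: "toggle e (toggle e V) = V"
  by (auto simp: toggle_def)

lemma sign_toggle:
  assumes "finite V"
  shows "- ((-1) ^ card (toggle e V)) = ((-1) ^ card V :: 'r::ring_1)"
proof (cases "e \<in> V")
  case True
  obtain k where "card V = Suc k" "card (V - {e}) = k" using card_Suc_Diff1[OF assms True] by metis
  thus ?thesis using True by (simp add: toggle_def)
qed (simp add: toggle_def assms)

lemma sum_split_filter:
  assumes "finite A"
  shows "sum f A = sum f {x\<in>A. P x} + sum f {x\<in>A. \<not> P x}"
proof -
  have "A = {x\<in>A. P x} \<union> {x\<in>A. \<not> P x}" by blast
  thus ?thesis using assms
    by (metis (lifting) disjoint_iff finite_Un mem_Collect_eq sum.union_disjoint)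
qed

text \<open>Each fibre contributes a factor -1. For the fibre of a chosen \<open>e\<close>,
  everything cancels except the sets meeting it in \<open>e\<close> alone; removing \<open>e\<close>
  from these leaves the same problem on the other fibres.\<close>

lemma sum_sign_surjective:
  assumes "finite A"
  shows "(\<Sum>V | V \<subseteq> A \<and> \<beta> ` V = \<beta> ` A. (-1) ^ card V :: 'r::field_char_0) = (-1) ^ card (\<beta> ` A)"
  using assms
proof (induction "card A" arbitrary: A rule: less_induct)
  case less
  show ?case
  proof (cases "A = {}")
    case True
    hence "{V. V \<subseteq> A \<and> \<beta> ` V = \<beta> ` A} = {{}}" by auto
    thus ?thesis using True by simp
  next
    case False
    then obtain e where e: "e \<in> A" by blast
    let ?F = "{i\<in>A. \<beta> i = \<beta> e}"
    let ?A' = "A - ?F"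
    let ?D = "{V. V \<subseteq> A \<and> \<beta> ` V = \<beta> ` A}"
    let ?S = "{V\<in>?D. V \<inter> ?F = {e}}"
    let ?R = "{V\<in>?D. V \<inter> ?F \<noteq> {e}}"
    let ?D' = "{V. V \<subseteq> ?A' \<and> \<beta> ` V = \<beta> ` ?A'}"
    let ?s = "\<lambda>V. (-1) ^ card V :: 'r"
    have finD: "finite ?D" by (rule finite_subset[of _ "Pow A"]) (use less.prems in blast)+
    have im: "\<beta> ` A = insert (\<beta> e) (\<beta> ` ?A')" "\<beta> e \<notin> \<beta> ` ?A'" using e by auto
    have "sum ?s ?D = sum ?s ?S + sum ?s ?R" by (rule sum_split_filter[OF finD, where P = "\<lambda>V. V \<inter> ?F = {e}"])
    \<comment> \<open>Such a set meets the fibre of \<open>e\<close> in some \<open>e'\<close> other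
      than \<open>e\<close>. Hence toggling \<open>e\<close> keeps both the image and membership in
      \<open>?R\<close>, and flips the sign.\<close>
    also have "sum ?s ?R = 0"
    proof -
      let ?t = "toggle e"
      have tD: "?t V \<in> ?R" if V: "V \<in> ?R" for V
      proof -
        have VA: "V \<subseteq> A" and VB: "\<beta> ` V = \<beta> ` A" and VF: "V \<inter> ?F \<noteq> {e}"
          using V by (simp_all only: mem_Collect_eq simp_thms)
        have "\<beta> e \<in> \<beta> ` V" unfolding VB using e by (rule imageI)
        then obtain u where u: "u \<in> V" "\<beta> u = \<beta> e" by (metis imageE)
        have "u \<in> V \<inter> ?F" using u VA by blast
        then obtain e' where e': "e' \<in> V" "e' \<in> ?F" "e' \<noteq> e" using VF by blast
        have "e' \<in> ?t V" using e' by (simp add: toggle_def)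
        hence "?t V \<inter> ?F \<noteq> {e}" using e' by blast
        moreover have "?t V \<subseteq> A" using VA e by (auto simp: toggle_def)
        moreover have "\<beta> ` ?t V = \<beta> ` A"
        proof -
          have "\<beta> ` ?t V = \<beta> ` V"
          proof (cases "e \<in> V")
            case True
            have "\<beta> e = \<beta> e'" "e' \<in> V - {e}" using e' by auto
            hence "\<beta> e \<in> \<beta> ` (V - {e})" by blast
            hence "\<beta> ` V = \<beta> ` (V - {e})" using True by blast
            thus ?thesis using True by (simp add: toggle_def)
          next
            case False
            thus ?thesis using \<open>\<beta> e \<in> \<beta> ` V\<close> by (simp add: toggle_def insert_absorb)
          qed
          thus ?thesis by (simp only: VB)
        qed
        ultimately show ?thesis by (simp only: mem_Collect_eq simp_thms)
      qed
      have tt: "?t (?t V) = V" for V by (rule toggle_toggle)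
      have "sum ?s ?R = sum (\<lambda>V. - ?s V) ?R"
      proof (rule sum.reindex_bij_witness[of _ ?t ?t])
        fix V assume V: "V \<in> ?R"
        hence "V \<subseteq> A" by (simp only: mem_Collect_eq simp_thms)
        hence "finite V" using less.prems finite_subset by blast
        thus "- ?s (?t V) = ?s V"
          by (rule sign_toggle)
      qed (simp_all only: tD tt)
      thus ?thesis by (simp add: sum_negf)
    qed
    also have "sum ?s ?S = sum (\<lambda>V. - ?s V) ?D'"
    proof (rule sum.reindex_bij_witness[of _ "insert e" "\<lambda>V. V - {e}"])
      fix V assume V: "V \<in> ?S"
      hence VA: "V \<subseteq> A" "\<beta> ` V = \<beta> ` A" "V \<inter> ?F = {e}" by (simp_all only: mem_Collect_eq simp_thms)
      have eV: "e \<in> V" using VA(3) by blast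
      show "insert e (V - {e}) = V" using eV by blast
      have sub: "V - {e} \<subseteq> ?A'" using VA by blast
      moreover have "\<beta> ` (V - {e}) = \<beta> ` ?A'"
      proof
        show "\<beta> ` (V - {e}) \<subseteq> \<beta> ` ?A'" using sub by blast
        show "\<beta> ` ?A' \<subseteq> \<beta> ` (V - {e})"
        proof
          fix x assume x: "x \<in> \<beta> ` ?A'"
          have "x \<in> \<beta> ` V" unfolding VA(2) using x by blast
          moreover have "x \<noteq> \<beta> e" using x im(2) by blast
          ultimately show "x \<in> \<beta> ` (V - {e})" by blast
        qed
      qed
      ultimately show "V - {e} \<in> ?D'" by (simp only: mem_Collect_eq simp_thms)
      have "finite V" using VA(1) less.prems finite_subset by blast
      thus "- ?s (V - {e}) = ?s V" using sign_toggle[of V e] eV by (simp add: toggle_def)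
    next
      fix V assume V: "V \<in> ?D'"
      hence VA: "V \<subseteq> ?A'" "\<beta> ` V = \<beta> ` ?A'" by (simp_all only: mem_Collect_eq simp_thms)
      have "e \<notin> V" using VA(1) e by blast
      thus "insert e V - {e} = V" by blast
      have "insert e V \<subseteq> A" "insert e V \<inter> ?F = {e}" using VA(1) e by auto
      moreover have "\<beta> ` insert e V = \<beta> ` A" unfolding im(1) image_insert VA(2) ..
      ultimately show "insert e V \<in> ?S" by (simp only: mem_Collect_eq simp_thms)
    qed
    also have "\<dots> = - ((-1) ^ card (\<beta> ` ?A'))"
    proof -
      have "card ?A' < card A" using less.prems e by (intro psubset_card_mono) auto
      thus ?thesis using less.hyps[of ?A'] less.prems by (simp add: sum_negf)
    qed
    also have "\<dots> + 0 = (-1) ^ card (\<beta> ` A)" unfolding im(1) using im(2) less.prems by simp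
    finally show ?thesis .
  qed
qed

text \<open>
  The alternating sum passes from words in the letters (non-base, base) to the dual basis for the
  letters (non-base, non-base + base).  This makes a fibre without marked position contribute the
  factor \<open>\<Sum>j. (-1) ^ j * (m choose j) = 0\<close>.
\<close>

definition alt_word_fn :: "nat \<Rightarrow> nat set \<Rightarrow> (nat \<Rightarrow>\<^sub>0 nat) \<Rightarrow> rat" where
  "alt_word_fn n U a = (\<Sum>W | W \<subseteq> {..<n} \<and> U \<subseteq> W. (-1) ^ card W * word_fn n W a)"

lemma alt_word_fn_rational_image: "alt_word_fn n U \<in> rational_image"
proof -
  have "(\<lambda>a. \<Sum>W | W \<subseteq> {..<n} \<and> U \<subseteq> W. (-1) ^ card W * word_fn n W a) \<in> rational_image"
    by (intro rational_image_sum rational_image_cmult word_fn_rational_image) simp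
  thus ?thesis by (simp add: alt_word_fn_def[abs_def])
qed

text \<open>Sifting preserves cardinality, hence the sign, so the sum over \<open>W\<close> unfolds
  into a sum over all \<open>V\<close> that sift to such a \<open>W\<close>.\<close>

lemma alt_word_fn_eq:
  assumes n: "mdegree a = n"
  shows "alt_word_fn n U a =
    (\<Sum>V | V \<subseteq> {..<n} \<and> U \<subseteq> sift n (level a) V. (-1) ^ card V) / of_nat (card (stabilizer n (level a)))"
proof -
  let ?\<beta> = "level a" and ?s = "of_nat (card (stabilizer n (level a))) :: rat"
  let ?A = "{V. V \<subseteq> {..<n} \<and> U \<subseteq> sift n ?\<beta> V}" and ?B = "{W. W \<subseteq> {..<n} \<and> U \<subseteq> W}"
  have fin: "finite ?A" "finite ?B" by (auto intro: finite_subset[of _ "Pow {..<n}"])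
  have "(\<Sum>V\<in>?A. (-1) ^ card V :: rat) = (\<Sum>V\<in>?A. (-1) ^ card (sift n ?\<beta> V))"
    by (intro sum.cong) (auto simp: card_sift)
  also have "\<dots> = (\<Sum>W\<in>?B. \<Sum>V | V \<in> ?A \<and> sift n ?\<beta> V = W. (-1) ^ card (sift n ?\<beta> V))"
    using fin sift_subset by (intro sum.group[symmetric]) auto
  also have "\<dots> = (\<Sum>W\<in>?B. (-1) ^ card W * of_nat (card {V\<in>Pow {..<n}. sift n ?\<beta> V = W}))"
  proof (rule sum.cong)
    fix W assume "W \<in> ?B"
    hence "{V. V \<in> ?A \<and> sift n ?\<beta> V = W} = {V\<in>Pow {..<n}. sift n ?\<beta> V = W}" by auto
    moreover have "(\<Sum>V | V \<in> ?A \<and> sift n ?\<beta> V = W. (-1) ^ card (sift n ?\<beta> V) :: rat) =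
        (\<Sum>V | V \<in> ?A \<and> sift n ?\<beta> V = W. (-1) ^ card W)" by (intro sum.cong) auto
    ultimately show "(\<Sum>V | V \<in> ?A \<and> sift n ?\<beta> V = W. (-1) ^ card (sift n ?\<beta> V)) =
        ((-1) ^ card W * of_nat (card {V\<in>Pow {..<n}. sift n ?\<beta> V = W}) :: rat)"
      by (simp only: sum_constant mult.commute)
  qed simp
  finally have "(\<Sum>V\<in>?A. (-1) ^ card V :: rat) / ?s =
      (\<Sum>W\<in>?B. (-1) ^ card W * of_nat (card {V\<in>Pow {..<n}. sift n ?\<beta> V = W})) / ?s" by simp
  thus ?thesis using n by (simp add: alt_word_fn_def word_fn_def sum_divide_distrib)
qed

text \<open>Sifting acts on each fibre separately. Toggling \<open>i\<close>, whose fibre misses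
  \<open>U\<close>, therefore does not affect whether \<open>U\<close> lies in the sifted set, and
  the signs cancel in pairs.\<close>

lemma alt_word_fn_eq_0:
  assumes n: "mdegree a = n" and i: "i < n" and no: "\<And>u. u \<in> U \<Longrightarrow> level a u \<noteq> level a i"
  shows "alt_word_fn n U a = 0"
proof -
  let ?\<beta> = "level a"
  let ?A = "{V. V \<subseteq> {..<n} \<and> U \<subseteq> sift n ?\<beta> V}"
  let ?t = "toggle i"
  have "{j\<in>?t V. ?\<beta> j = ?\<beta> u} = {j\<in>V. ?\<beta> j = ?\<beta> u}" if "u \<in> U" for u V
    using no[OF that] by (auto simp: toggle_def split: if_splits)
  hence "u \<in> sift n ?\<beta> (?t V) \<longleftrightarrow> u \<in> sift n ?\<beta> V" if "u \<in> U" for u V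
    using that by (simp add: sift_def)
  hence "U \<subseteq> sift n ?\<beta> (?t V) \<longleftrightarrow> U \<subseteq> sift n ?\<beta> V" for V by blast
  moreover have "?t V \<subseteq> {..<n}" if "V \<subseteq> {..<n}" for V using that i by (auto simp: toggle_def)
  ultimately have tA: "?t V \<in> ?A" if "V \<in> ?A" for V using that by blast
  have tt: "?t (?t V) = V" for V by (rule toggle_toggle)
  have "(\<Sum>V\<in>?A. (-1) ^ card V :: rat) = (\<Sum>V\<in>?A. - ((-1) ^ card V))"
  proof (rule sum.reindex_bij_witness[of _ ?t ?t])
    fix V assume "V \<in> ?A"
    hence "finite V" using finite_subset by blast
    thus "- ((-1) ^ card (?t V)) = ((-1) ^ card V :: rat)"
      by (rule sign_toggle)
  qed (simp_all only: tA tt)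
  hence "(\<Sum>V\<in>?A. (-1) ^ card V :: rat) = 0" by (simp add: sum_negf)
  thus ?thesis by (simp add: alt_word_fn_eq[OF n])
qed

text \<open>An end is the last position of its fibre, so it belongs to the sift of \<open>V\<close>
  as soon as \<open>V\<close> meets that fibre. The sum thus runs over the \<open>V\<close> that
  meet every fibre, and is 1 or -1.\<close>

lemma alt_word_fn_ends:
  assumes n: "mdegree a = n"
  shows "alt_word_fn n (ends n (level a)) a \<noteq> 0"
proof -
  let ?\<beta> = "level a"
  have mono: "?\<beta> i \<le> ?\<beta> j" if "i \<le> j" "j < n" for i j using level_mono that n by blast
  have "ends n ?\<beta> \<subseteq> sift n ?\<beta> V \<longleftrightarrow> ?\<beta> ` V = ?\<beta> ` {..<n}" if V: "V \<subseteq> {..<n}" for V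
  proof -
    have fin: "finite V" using V finite_subset by blast
    have "e \<in> sift n ?\<beta> V \<longleftrightarrow> ?\<beta> e \<in> ?\<beta> ` V" if e: "e \<in> ends n ?\<beta>" for e
    proof -
      have en: "e < n" "\<And>j. e < j \<Longrightarrow> j < n \<Longrightarrow> ?\<beta> j \<noteq> ?\<beta> e" using e by (auto simp: ends_def)
      have "{j. e \<le> j \<and> j < n \<and> ?\<beta> j = ?\<beta> e} = {e}" using en by (auto simp: le_less)
      hence "e \<in> sift n ?\<beta> V \<longleftrightarrow> 1 \<le> card {j\<in>V. ?\<beta> j = ?\<beta> e}" using en(1) by (simp add: sift_def)
      also have "\<dots> \<longleftrightarrow> {j\<in>V. ?\<beta> j = ?\<beta> e} \<noteq> {}"
        using fin by (simp add: Suc_le_eq card_gt_0_iff)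
      also have "\<dots> \<longleftrightarrow> ?\<beta> e \<in> ?\<beta> ` V" by (auto simp: image_iff eq_commute[of "?\<beta> e"])
      finally show ?thesis .
    qed
    hence "ends n ?\<beta> \<subseteq> sift n ?\<beta> V \<longleftrightarrow> ?\<beta> ` ends n ?\<beta> \<subseteq> ?\<beta> ` V" by blast
    also have "?\<beta> ` ends n ?\<beta> = ?\<beta> ` {..<n}"
    proof
      show "?\<beta> ` ends n ?\<beta> \<subseteq> ?\<beta> ` {..<n}" by (auto simp: ends_def)
      show "?\<beta> ` {..<n} \<subseteq> ?\<beta> ` ends n ?\<beta>"
      proof (intro image_subsetI)
        fix i assume "i \<in> {..<n}"
        then obtain e where "e \<in> ends n ?\<beta>" "?\<beta> e = ?\<beta> i"
          using ex_end[of n ?\<beta> i, OF mono] by auto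
        thus "?\<beta> i \<in> ?\<beta> ` ends n ?\<beta>" by (metis imageI)
      qed
    qed
    finally show ?thesis using V by blast
  qed
  hence "{V. V \<subseteq> {..<n} \<and> ends n ?\<beta> \<subseteq> sift n ?\<beta> V} = {V. V \<subseteq> {..<n} \<and> ?\<beta> ` V = ?\<beta> ` {..<n}}"
    by blast
  thus ?thesis
    using sum_sign_surjective[of "{..<n}" ?\<beta>, where 'r = rat] card_stabilizer_pos[of n ?\<beta>]
    by (simp add: alt_word_fn_eq[OF n])
qed

section \<open>Triangularity with respect to the monomial basis\<close>

text \<open>
  Each fibre of \<open>\<beta>\<close> has exactly one end, and sending it to a marked position of the same fibre is
  injective and weakly decreasing.
\<close>

lemma ends_weight_less:
  assumes U: "U \<subseteq> {..<n}" and meet: "\<And>i. i < n \<Longrightarrow> \<exists>u\<in>U. \<beta> u = \<beta> i" and ne: "ends n \<beta> \<noteq> U"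
  shows "(\<Sum>e\<in>ends n \<beta>. n - e) < (\<Sum>u\<in>U. n - u)"
proof -
  let ?V = "ends n \<beta>"
  have finV: "finite ?V" and Vn: "?V \<subseteq> {..<n}" by (auto simp: ends_def)
  have finU: "finite U" using U finite_subset by blast
  have "\<exists>u\<in>U. \<beta> u = \<beta> e" if "e \<in> ?V" for e using meet that Vn by blast
  then obtain \<phi> where \<phi>: "\<And>e. e \<in> ?V \<Longrightarrow> \<phi> e \<in> U" "\<And>e. e \<in> ?V \<Longrightarrow> \<beta> (\<phi> e) = \<beta> e" by metis
  have le: "\<phi> e \<le> e" if e: "e \<in> ?V" for e
  proof (rule ccontr)
    assume "\<not> \<phi> e \<le> e"
    hence "\<beta> e < \<beta> (\<phi> e)" using e \<phi>(1)[OF e] U by (auto simp: ends_def)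
    thus False using \<phi>(2)[OF e] by simp
  qed
  have inj: "inj_on \<phi> ?V"
  proof (rule inj_onI)
    fix e e' assume e: "e \<in> ?V" "e' \<in> ?V" "\<phi> e = \<phi> e'"
    hence "\<beta> e = \<beta> e'" using \<phi>(2) by metis
    thus "e = e'" using e(1,2) by (auto simp: ends_def) (metis less_irrefl linorder_neqE_nat)
  qed
  have "(\<Sum>e\<in>?V. n - \<phi> e) = (\<Sum>u\<in>\<phi> ` ?V. n - u)" by (simp add: sum.reindex[OF inj])
  also have "\<dots> \<le> (\<Sum>u\<in>U. n - u)" using finU \<phi>(1) by (intro sum_mono2) auto
  finally have 1: "(\<Sum>e\<in>?V. n - \<phi> e) \<le> (\<Sum>u\<in>U. n - u)" .
  show ?thesis
  proof (cases "\<exists>e\<in>?V. \<phi> e \<noteq> e")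
    case True
    then obtain e where e: "e \<in> ?V" "\<phi> e \<noteq> e" by blast
    hence "n - e < n - \<phi> e" using le[OF e(1)] Vn by auto
    hence "(\<Sum>e\<in>?V. n - e) < (\<Sum>e\<in>?V. n - \<phi> e)"
      using finV le e by (intro sum_strict_mono_ex1) (auto intro: diff_le_mono2)
    thus ?thesis using 1 by simp
  next
    case False
    hence "?V \<subseteq> U" using \<phi>(1) by force
    hence "?V \<subset> U" using ne by blast
    then obtain u where u: "u \<in> U - ?V" by blast
    show ?thesis by (rule sum_strict_mono2[OF finU \<open>?V \<subseteq> U\<close> u]) (use u U in auto)
  qed
qed

text \<open>The monomial quasisymmetric function of the composition of \<open>n\<close> encoded by
  \<open>U\<close>, or zero if \<open>U\<close> is not the end set of any such word.\<close>

definition ends_indicator :: "nat \<Rightarrow> nat set \<Rightarrow> (nat \<Rightarrow>\<^sub>0 nat) \<Rightarrow> rat" where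
  "ends_indicator n U a = (if mdegree a = n \<and> ends n (level a) = U then 1 else 0)"

lemma sum_ends_indicator:
  assumes "finite \<U>"
  shows "(\<Sum>U\<in>\<U>. \<kappa> U * ends_indicator n U a) =
    (if mdegree a = n \<and> ends n (level a) \<in> \<U> then \<kappa> (ends n (level a)) else 0)"
proof -
  have "(\<Sum>U\<in>\<U>. \<kappa> U * ends_indicator n U a) =
      (\<Sum>U\<in>\<U>. if U = ends n (level a) then (if mdegree a = n then \<kappa> U else 0) else 0)"
    by (intro sum.cong) (auto simp: ends_indicator_def)
  thus ?thesis using assms by simp
qed

text \<open>In the expansion of \<open>alt_word_fn n U\<close>, every term other than
  \<open>U\<close> itself has an end set of smaller weight. Those terms are available by induction
  and can be subtracted.\<close>

lemma ends_indicator_rational_image: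
  "U \<subseteq> {..<n} \<Longrightarrow> ends_indicator n U \<in> rational_image"
proof (induction "\<Sum>u\<in>U. n - u" arbitrary: U rule: less_induct)
  case less
  show ?case
  proof (cases "\<exists>a. mdegree a = n \<and> ends n (level a) = U")
    case False
    hence "ends_indicator n U = (\<lambda>_. 0)" by (auto simp: ends_indicator_def)
    thus ?thesis by (simp add: rational_image_0)
  next
    case True
    then obtain a0 where a0: "mdegree a0 = n" "ends n (level a0) = U" by blast
    define c where "c = alt_word_fn n U a0"
    have c: "c \<noteq> 0" using alt_word_fn_ends[OF a0(1)] a0(2) by (simp add: c_def)
    \<comment> \<open>The coefficient at \<open>V\<close>, read off at any monomial with end set
      \<open>V\<close>. If there is none, the value is arbitrary but multiplies a zero
      function.\<close>
    define \<kappa> where "\<kappa> V = alt_word_fn n U (SOME a. mdegree a = n \<and> ends n (level a) = V)" for V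
    have \<kappa>: "\<kappa> (ends n (level a)) = alt_word_fn n U a" if "mdegree a = n" for a
    proof -
      let ?b = "SOME b. mdegree b = n \<and> ends n (level b) = ends n (level a)"
      have "mdegree ?b = n \<and> ends n (level ?b) = ends n (level a)"
        by (rule someI[of _ a]) (simp add: that)
      thus ?thesis unfolding \<kappa>_def
        using rational_image_ends[OF alt_word_fn_rational_image, of ?b n a] that by blast
    qed
    let ?\<U> = "{V. V \<subseteq> {..<n} \<and> (\<Sum>u\<in>V. n - u) < (\<Sum>u\<in>U. n - u)}"
    have fin: "finite ?\<U>" by (auto intro: finite_subset[of _ "Pow {..<n}"])
    have "(\<lambda>a. inverse c * (alt_word_fn n U a - (\<Sum>V\<in>?\<U>. \<kappa> V * ends_indicator n V a))) \<in> rational_image"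
      using less.hyps
      by (intro rational_image_cmult rational_image_diff rational_image_sum alt_word_fn_rational_image) auto
    moreover have "inverse c * (alt_word_fn n U a - (\<Sum>V\<in>?\<U>. \<kappa> V * ends_indicator n V a)) =
        ends_indicator n U a" for a
    proof (cases "mdegree a = n")
      case False
      thus ?thesis using fin
        by (simp add: sum_ends_indicator alt_word_fn_def word_fn_def ends_indicator_def)
    next
      case n: True
      let ?V = "ends n (level a)"
      have Vn: "?V \<subseteq> {..<n}" by (auto simp: ends_def)
      consider "?V = U" | "?V \<noteq> U" "?V \<in> ?\<U>" | "?V \<noteq> U" "?V \<notin> ?\<U>" by blast
      thus ?thesis
      proof cases
        case 1
        hence "alt_word_fn n U a = c"
          unfolding c_def using rational_image_ends[OF alt_word_fn_rational_image n a0(1)] a0(2) by simp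
        thus ?thesis using 1 n c fin by (simp add: sum_ends_indicator) (simp add: ends_indicator_def)
      next
        case 2
        thus ?thesis using n c fin \<kappa> by (simp add: sum_ends_indicator) (simp add: ends_indicator_def)
      next
        \<comment> \<open>By the contrapositive of \<open>ends_weight_less\<close>, the set
          \<open>U\<close> misses a fibre of \<open>level a\<close>, which makes
          \<open>alt_word_fn\<close> vanish.\<close>
        case 3
        hence "\<not> (\<forall>i<n. \<exists>u\<in>U. level a u = level a i)"
          using ends_weight_less[OF less.prems, of "level a"] Vn by blast
        then obtain i where i: "i < n" "\<forall>u\<in>U. level a u \<noteq> level a i" by blast
        have "alt_word_fn n U a = 0" by (rule alt_word_fn_eq_0[OF n i(1)]) (use i(2) in blast)
        thus ?thesis unfolding sum_ends_indicator[OF fin] unfolding ends_indicator_def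
          using 3 by auto
      qed
    qed
    ultimately show ?thesis by simp
  qed
qed

text \<open>The degree bound makes the expansion in the monomial basis finite.\<close>

lemma quasisymmetric_rational_image:
  assumes h: "quasisymmetric h"
  shows "(\<lambda>a. of_int (h a)) \<in> rational_image"
proof -
  obtain d where d: "\<And>a. h a \<noteq> 0 \<Longrightarrow> mdegree a \<le> d" using h by (auto simp: quasisymmetric_def)
  define \<kappa> where "\<kappa> n V = (of_int (h (SOME a. mdegree a = n \<and> ends n (level a) = V)) :: rat)" for n V
  have \<kappa>: "\<kappa> n (ends n (level a)) = of_int (h a)" if "mdegree a = n" for n a
  proof -
    let ?b = "SOME b. mdegree b = n \<and> ends n (level b) = ends n (level a)"
    have "mdegree ?b = n \<and> ends n (level ?b) = ends n (level a)"
      by (rule someI[of _ a]) (simp add: that)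
    thus ?thesis unfolding \<kappa>_def using quasisymmetric_ends[OF h, of ?b n a] that by simp
  qed
  have "(\<lambda>a. \<Sum>n\<le>d. \<Sum>V\<in>Pow {..<n}. \<kappa> n V * ends_indicator n V a) \<in> rational_image"
    by (intro rational_image_sum rational_image_cmult ends_indicator_rational_image) simp
  moreover have "(\<Sum>n\<le>d. \<Sum>V\<in>Pow {..<n}. \<kappa> n V * ends_indicator n V a) = of_int (h a)" for a
  proof -
    have "(\<Sum>V\<in>Pow {..<n}. \<kappa> n V * ends_indicator n V a) = (if n = mdegree a then of_int (h a) else 0)"
      for n
      using \<kappa>[of a n] by (auto simp: sum_ends_indicator ends_def)
    thus ?thesis using d[of a] by auto
  qed
  ultimately show ?thesis by simp
qed

section \<open>Surjectivity\<close>

lemma qcoeff_sum: "qcoeff (\<Sum>i\<in>I. q i) a = (\<Sum>i\<in>I. qcoeff (q i) a)"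
  by (induction I rule: infinite_finite_induct) (simp_all add: plus_qsym.rep_eq zero_qsym.rep_eq)

text \<open>The rational result with cleared denominators; the multiple is written as a repeated sum
  within the additive group \<open>qsym\<close>.\<close>

lemma ex_multiple_in_range_mat_qsym:
  "\<exists>N>0. \<exists>m. mat_qsym m = (\<Sum>i<(N::nat). q)"
proof -
  have "quasisymmetric (qcoeff q)" using qcoeff by blast
  then obtain N m where N: "N > 0"
    "\<And>a. of_nat N * (of_int (qcoeff q a) :: rat) = of_int (qcoeff (mat_qsym m) a)"
    using quasisymmetric_rational_image unfolding rational_image_def by blast
  have "qcoeff (mat_qsym m) a = qcoeff (\<Sum>i<N. q) a" for a
  proof -
    have "(of_int (int N * qcoeff q a) :: rat) = of_int (qcoeff (mat_qsym m) a)" using N(2) by simp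
    thus ?thesis unfolding qcoeff_sum of_int_eq_iff by simp
  qed
  hence "mat_qsym m = (\<Sum>i<N. q)" by (simp add: qcoeff_inject[symmetric] fun_eq_iff)
  thus ?thesis using N(1) by blast
qed

text \<open>Biadditivity lets a natural multiple pass from one factor to the other.\<close>

lemma pure_tensor_sum_shift: "(\<Sum>i<(n::nat). a) \<otimes>\<^sub>t b = a \<otimes>\<^sub>t (\<Sum>i<n. b)"
proof (induction n)
  case 0
  have "(0::'a) \<otimes>\<^sub>t b = 0" using pure_tensor_add_left[of 0 0 b] by simp
  moreover have "a \<otimes>\<^sub>t (0::'b) = 0" using pure_tensor_add_right[of a 0 0] by simp
  ultimately show ?case by simp
qed (simp add: pure_tensor_add_left pure_tensor_add_right)

lemma tensor_induct:
  assumes "P 0" "\<And>a b. P (a \<otimes>\<^sub>t b)" "\<And>u v. P u \<Longrightarrow> P v \<Longrightarrow> P (u - v)"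
  shows "P u"
proof (rule tensor.abs_induct[of P u])
  fix f
  show "P (abs_tensor f)"
  proof (rule frag_induction[where S = UNIV and c = f and P = "\<lambda>f. P (abs_tensor f)"])
    show "P (abs_tensor 0)" using assms(1) by (simp add: zero_tensor_def)
    show "P (abs_tensor (frag_of x))" for x
      using assms(2)[of "fst x" "snd x"] by (simp add: pure_tensor.abs_eq)
    show "P (abs_tensor (x - y))" if "P (abs_tensor x)" "P (abs_tensor y)" for x y
      using assms(3)[OF that] by (simp add: minus_tensor.abs_eq)
  qed simp
qed

theorem theorem10p1:
  shows "surj (mat_qsym_tensor :: (mat, 'k::field_char_0) tensor \<Rightarrow> (qsym, 'k) tensor)"
proof -
  let ?F = "mat_qsym_tensor :: (mat, 'k) tensor \<Rightarrow> (qsym, 'k) tensor"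
  have F0: "?F 0 = 0" using mat_qsym_tensor_add[of 0 0] by simp
  have Fdiff: "?F (u - v) = ?F u - ?F v" for u v
    using mat_qsym_tensor_add[of "u - v" v] by (simp add: algebra_simps)
  have "u \<in> range ?F" for u
  proof (induction u rule: tensor_induct)
    case 1
    show ?case by (rule range_eqI[of _ _ 0]) (simp only: F0)
  next
    case (2 q k)
    obtain N m where N: "N > 0" "mat_qsym m = (\<Sum>i<(N::nat). q)"
      using ex_multiple_in_range_mat_qsym by blast
    \<comment> \<open>Characteristic zero allows division of \<open>k\<close> by \<open>N\<close>;
      the factor \<open>N\<close> then moves to \<open>q\<close>, and this multiple of
      \<open>q\<close> is in the range of \<open>mat_qsym\<close>.\<close>
    have "q \<otimes>\<^sub>t k = q \<otimes>\<^sub>t (\<Sum>i<N. k / of_nat N)" using N(1) by simp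
    also have "\<dots> = ?F (m \<otimes>\<^sub>t (k / of_nat N))"
      unfolding mat_qsym_tensor_pure N(2) pure_tensor_sum_shift ..
    finally show ?case by (rule range_eqI)
  next
    case (3 u v)
    then obtain u' v' where "u = ?F u'" "v = ?F v'" by (elim rangeE)
    thus ?case using Fdiff by (intro range_eqI[of _ _ "u' - v'"]) simp
  qed
  thus ?thesis by (rule UNIV_eq_I[symmetric])
qed

end
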